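(* For every $n\geq 3$, there exist $\tau_n$-Markov maps on $M_n(\mathbb{C})$ which do not satisfy the asymptotic quantum Birkhoff property, i.e. $\tau_n$-Markov maps $T$ for which it is not true that $$\lim_{k\to\infty} d_{\mathrm{cb}}\Big(\bigotimes_{i=1}^k T,\ \mathrm{conv}\big(\mathrm{Aut}\big(\bigotimes_{i=1}^k M_n(\mathbb{C})\big)\big)\Big)=0.$$
   Context: $\tau_n$ is the normalized trace on $M_n(\mathbb{C})$. A $\tau_n$-Markov map on $M_n(\mathbb{C})$ is a completely positive, unital linear map $T$ with $\tau_n\circ T=\tau_n$. $\mathrm{Aut}(A)$ is the set of $*$-automorphisms of $A$, $\mathrm{conv}$ denotes convex hull, and $d_{\mathrm{cb}}(S,\mathcal{C})=\inf_{R\in\mathcal{C}}\|S-R\|_{\mathrm{cb}}$ is the distance with respect to the completely bounded norm. *)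

theory Defs
  imports
    "Jordan_Normal_Form.Schur_Decomposition"
    "HOL-Analysis.L2_Norm"
    "HOL-Library.Extended_Nonnegative_Real"
begin

text \<open>
  The algebra of complex \<open>N \<times> N\<close> matrices is \<^term>\<open>carrier_mat N N :: complex mat set\<close>.  Maps between
  matrix algebras are HOL functions on \<^typ>\<open>complex mat\<close>, and only their values on the carrier matter:
  every notion below depends on a map only through its restriction to the carrier.

  The tensor product of the \<open>a \<times> a\<close> and the \<open>b \<times> b\<close> matrices is identified with the
  \<open>(a * b) \<times> (a * b)\<close> matrices through the Kronecker product: the index pair \<open>(i, p)\<close> with
  \<open>i < a\<close> and \<open>p < b\<close> is encoded as \<open>i * b + p\<close>.  Under this \<open>*\<close>-isomorphism the \<open>k\<close>-fold
  tensor power of the \<open>n \<times> n\<close> matrices is the algebra of \<open>n ^ k \<times> n ^ k\<close> matrices.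
\<close>

definition mat_linear :: "nat \<Rightarrow> nat \<Rightarrow> (complex mat \<Rightarrow> complex mat) \<Rightarrow> bool" where
  "mat_linear a b S \<longleftrightarrow>
     S \<in> carrier_mat a a \<rightarrow> carrier_mat b b \<and>
     (\<forall>X\<in>carrier_mat a a. \<forall>Y\<in>carrier_mat a a. S (X + Y) = S X + S Y) \<and>
     (\<forall>c. \<forall>X\<in>carrier_mat a a. S (c \<cdot>\<^sub>m X) = c \<cdot>\<^sub>m S X)"

text \<open>The order on \<^typ>\<open>complex\<close> is the one for which \<open>0 \<le> z\<close> says that \<open>z\<close> is real and
  non-negative, and \<open>v \<bullet>c w\<close> is the inner product, conjugate-linear in \<open>w\<close>.\<close>

definition psd :: "nat \<Rightarrow> complex mat \<Rightarrow> bool" where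
  "psd N A \<longleftrightarrow> A \<in> carrier_mat N N \<and> (\<forall>v\<in>carrier_vec N. 0 \<le> (A *\<^sub>v v) \<bullet>c v)"

definition norm_trace :: "nat \<Rightarrow> complex mat \<Rightarrow> complex" where
  "norm_trace n A = (\<Sum>i<n. A $$ (i, i)) / of_nat n"

definition mat_block :: "nat \<Rightarrow> complex mat \<Rightarrow> nat \<Rightarrow> nat \<Rightarrow> complex mat" where
  "mat_block N X i j = mat N N (\<lambda>(p, q). X $$ (i * N + p, j * N + q))"

text \<open>The \<open>m\<close>-th amplification \<open>id \<otimes> S\<close> of a map \<open>S\<close> on \<open>N \<times> N\<close> matrices: it sends the
  \<open>m \<times> m\<close> block matrix \<open>[X\<^sub>i\<^sub>j]\<close> with \<open>N \<times> N\<close> blocks to \<open>[S X\<^sub>i\<^sub>j]\<close>.\<close>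

definition amplify :: "nat \<Rightarrow> nat \<Rightarrow> (complex mat \<Rightarrow> complex mat) \<Rightarrow> complex mat \<Rightarrow> complex mat" where
  "amplify m N S X =
     mat (m * N) (m * N) (\<lambda>(r, s). S (mat_block N X (r div N) (s div N)) $$ (r mod N, s mod N))"

definition completely_positive :: "nat \<Rightarrow> (complex mat \<Rightarrow> complex mat) \<Rightarrow> bool" where
  "completely_positive N S \<longleftrightarrow>
     mat_linear N N S \<and> (\<forall>m\<ge>1. \<forall>X. psd (m * N) X \<longrightarrow> psd (m * N) (amplify m N S X))"

definition markov_map :: "nat \<Rightarrow> (complex mat \<Rightarrow> complex mat) \<Rightarrow> bool" where
  "markov_map n T \<longleftrightarrow>
     completely_positive n T \<and> T (1\<^sub>m n) = 1\<^sub>m n \<and>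
     (\<forall>X\<in>carrier_mat n n. norm_trace n (T X) = norm_trace n X)"

definition star_automorphisms :: "nat \<Rightarrow> (complex mat \<Rightarrow> complex mat) set" where
  "star_automorphisms N =
     {\<phi>. mat_linear N N \<phi> \<and> bij_betw \<phi> (carrier_mat N N) (carrier_mat N N) \<and>
        (\<forall>X\<in>carrier_mat N N. \<forall>Y\<in>carrier_mat N N. \<phi> (X * Y) = \<phi> X * \<phi> Y) \<and>
        (\<forall>X\<in>carrier_mat N N. \<phi> (mat_adjoint X) = mat_adjoint (\<phi> X))}"

text \<open>The library's \<^const>\<open>hull\<close> of \<open>convex\<close> sets is not applicable, since \<^typ>\<open>complex mat\<close> contains
  matrices of all sizes and is not a real vector space; hence the explicit convex combinations.\<close>

definition conv_maps :: "nat \<Rightarrow> (complex mat \<Rightarrow> complex mat) set \<Rightarrow> (complex mat \<Rightarrow> complex mat) set" where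
  "conv_maps N F =
     {R. \<exists>(l::nat) (c :: nat \<Rightarrow> real) \<phi>.
        (\<forall>i<l. 0 \<le> c i \<and> \<phi> i \<in> F) \<and> (\<Sum>i<l. c i) = 1 \<and>
        (\<forall>X\<in>carrier_mat N N.
           R X = mat N N (\<lambda>rs. \<Sum>i<l. complex_of_real (c i) * \<phi> i X $$ rs))}"

definition l2_norm :: "complex vec \<Rightarrow> real" where
  "l2_norm v = L2_set (\<lambda>i. cmod (v $ i)) {..<dim_vec v}"

text \<open>Norms are taken in \<^typ>\<open>ennreal\<close>, so that the suprema and the infimum below need no
  boundedness side conditions.\<close>

definition op_norm :: "complex mat \<Rightarrow> ennreal" where
  "op_norm A = (SUP v\<in>{v\<in>carrier_vec (dim_col A). l2_norm v \<le> 1}. ennreal (l2_norm (A *\<^sub>v v)))"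

definition cb_norm :: "nat \<Rightarrow> (complex mat \<Rightarrow> complex mat) \<Rightarrow> ennreal" where
  "cb_norm N S =
     (SUP m\<in>{1..}. SUP X\<in>{X\<in>carrier_mat (m * N) (m * N). op_norm X \<le> 1}. op_norm (amplify m N S X))"

definition cb_dist :: "nat \<Rightarrow> (complex mat \<Rightarrow> complex mat) \<Rightarrow> (complex mat \<Rightarrow> complex mat) set \<Rightarrow> ennreal" where
  "cb_dist N S C = (INF R\<in>C. cb_norm N (\<lambda>X. S X - R X))"

definition kron :: "nat \<Rightarrow> nat \<Rightarrow> complex mat \<Rightarrow> complex mat \<Rightarrow> complex mat" where
  "kron a b A B =
     mat (a * b) (a * b) (\<lambda>(r, s). A $$ (r div b, s div b) * B $$ (r mod b, s mod b))"

definition mat_unit :: "nat \<Rightarrow> nat \<times> nat \<Rightarrow> complex mat" where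
  "mat_unit N ij = mat N N (\<lambda>rs. if rs = ij then 1 else 0)"

text \<open>The tensor product of a linear map \<open>S\<close> on \<open>a \<times> a\<close> matrices and a linear map \<open>R\<close> on \<open>b \<times> b\<close>
  matrices: expand \<open>X\<close> in the basis of tensor products \<open>E\<^sub>i\<^sub>j \<otimes> E\<^sub>p\<^sub>q\<close> of matrix units and apply
  \<open>S\<close> and \<open>R\<close> to the two legs. It is characterized by the lemma \<open>tensor_map_kron\<close> below.\<close>

definition tensor_map ::
  "nat \<Rightarrow> nat \<Rightarrow> (complex mat \<Rightarrow> complex mat) \<Rightarrow> (complex mat \<Rightarrow> complex mat) \<Rightarrow> complex mat \<Rightarrow> complex mat" where
  "tensor_map a b S R X =
     mat (a * b) (a * b) (\<lambda>rs.
       \<Sum>(i, j)\<in>{..<a} \<times> {..<a}. \<Sum>(p, q)\<in>{..<b} \<times> {..<b}.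
         X $$ (i * b + p, j * b + q) * kron a b (S (mat_unit a (i, j))) (R (mat_unit b (p, q))) $$ rs)"

primrec tensor_power :: "nat \<Rightarrow> (complex mat \<Rightarrow> complex mat) \<Rightarrow> nat \<Rightarrow> complex mat \<Rightarrow> complex mat" where
  "tensor_power n T 0 = (\<lambda>X. X)"
| "tensor_power n T (Suc k) = tensor_map n (n ^ k) T (tensor_power n T k)"

definition asymptotic_quantum_birkhoff :: "nat \<Rightarrow> (complex mat \<Rightarrow> complex mat) \<Rightarrow> bool" where
  "asymptotic_quantum_birkhoff n T \<longleftrightarrow>
     (\<lambda>k. cb_dist (n ^ k) (tensor_power n T k) (conv_maps (n ^ k) (star_automorphisms (n ^ k))))
       \<longlonglongrightarrow> 0"

lemma mat_linear_expand:
  assumes S: "mat_linear a b S" and A: "A \<in> carrier_mat a a" and rs: "fst rs < b" "snd rs < b"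
  shows "S A $$ rs = (\<Sum>ij\<in>{..<a} \<times> {..<a}. A $$ ij * S (mat_unit a ij) $$ rs)"
proof -
  define P where "P F = mat a a (\<lambda>ij. if ij \<in> F then A $$ ij else 0)" for F
  have cS: "S Y \<in> carrier_mat b b" if "Y \<in> carrier_mat a a" for Y
    using S that unfolding mat_linear_def by auto
  have cP: "P F \<in> carrier_mat a a" for F unfolding P_def by simp
  have cE: "mat_unit a ij \<in> carrier_mat a a" for ij unfolding mat_unit_def by simp
  have *: "S (P F) $$ rs = (\<Sum>ij\<in>F. A $$ ij * S (mat_unit a ij) $$ rs)"
    if "finite F" "F \<subseteq> {..<a} \<times> {..<a}" for F
    using that
  proof (induction F rule: finite_induct)
    case empty
    have "P {} = 0 \<cdot>\<^sub>m P {}" unfolding P_def by (intro eq_matI) auto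
    then have "S (P {}) = 0 \<cdot>\<^sub>m S (P {})"
      using S cP unfolding mat_linear_def by metis
    then have "S (P {}) $$ rs = (0 \<cdot>\<^sub>m S (P {})) $$ rs" by simp
    also have "\<dots> = 0" using cS[OF cP[of "{}"]] rs by (cases rs) auto
    finally show ?case by simp
  next
    case (insert x F)
    have "P (insert x F) = A $$ x \<cdot>\<^sub>m mat_unit a x + P F"
      using insert.hyps unfolding P_def mat_unit_def by (intro eq_matI) auto
    then have "S (P (insert x F)) = A $$ x \<cdot>\<^sub>m S (mat_unit a x) + S (P F)"
      using S cP[of F] cE[of x] unfolding mat_linear_def by (metis smult_carrier_mat)
    then have "S (P (insert x F)) $$ rs = A $$ x * S (mat_unit a x) $$ rs + S (P F) $$ rs"
      using cS[OF cP[of F]] cS[OF cE[of x]] rs by (cases rs) auto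
    then show ?case using insert by simp
  qed
  have "P ({..<a} \<times> {..<a}) = A" unfolding P_def using A by (intro eq_matI) auto
  then show ?thesis using *[of "{..<a} \<times> {..<a}"] by simp
qed

lemma tensor_map_kron:
  assumes S: "mat_linear a a S" and R: "mat_linear b b R"
    and A: "A \<in> carrier_mat a a" and B: "B \<in> carrier_mat b b"
  shows "tensor_map a b S R (kron a b A B) = kron a b (S A) (R B)"
proof (rule eq_matI)
  fix r s
  assume "r < dim_row (kron a b (S A) (R B))" "s < dim_col (kron a b (S A) (R B))"
  then have r: "r < a * b" and s: "s < a * b" by (auto simp: kron_def)
  have b: "b > 0" using r by (cases b) auto
  have rs: "r div b < a" "s div b < a" "r mod b < b" "s mod b < b"
    using r s b by (auto simp: less_mult_imp_div_less)
  have ip: "i * b + p < a * b" if "i < a" "p < b" for i p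
  proof -
    have "i * b + p < Suc i * b" using that by simp
    also have "\<dots> \<le> a * b" using that by (intro mult_right_mono) auto
    finally show ?thesis .
  qed
  have "tensor_map a b S R (kron a b A B) $$ (r, s) =
      (\<Sum>(i, j)\<in>{..<a} \<times> {..<a}. \<Sum>(p, q)\<in>{..<b} \<times> {..<b}.
         (A $$ (i, j) * S (mat_unit a (i, j)) $$ (r div b, s div b)) *
         (B $$ (p, q) * R (mat_unit b (p, q)) $$ (r mod b, s mod b)))"
    unfolding tensor_map_def using r s b
    by (auto intro!: sum.cong simp: kron_def ip)
  also have "\<dots> = S A $$ (r div b, s div b) * R B $$ (r mod b, s mod b)"
    using rs by (simp add: mat_linear_expand[OF S A] mat_linear_expand[OF R B] sum_product case_prod_unfold)
  finally show "tensor_map a b S R (kron a b A B) $$ (r, s) = kron a b (S A) (R B) $$ (r, s)"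
    using r s by (simp add: kron_def)
qed (auto simp: kron_def tensor_map_def)

end

theory Submission
  imports Defs
begin

text \<open>
  The map \<open>T\<close> acts on the upper left \<open>3 \<times> 3\<close> corner as the Werner--Holevo channel
  \<open>X \<mapsto> (Tr X - X\<^sup>t) / 2\<close>, whose Kraus operators span the antisymmetric matrices, and as the
  identity on the complementary corner. Put \<open>m = n\<^sup>k\<close>, let \<open>f\<^sub>i\<^sub>j = E\<^sub>i\<^sub>j \<otimes> 1\<close> in
  \<open>M\<^sub>n \<otimes> M\<^sub>m\<close>, and test a map \<open>S\<close> against the linear functional
  \<open>\<Sum> Tr (S(f\<^sub>i\<^sub>j) f\<^sub>i\<^sub>j)\<close>, summed over \<open>i, j < 3\<close>, which is bounded by \<open>9 m\<close> times the cb-norm. Its value at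
  the tensor power of \<open>T\<close> is \<open>-3 m\<close>.

  An automorphism given by a unitary with blocks \<open>u\<^sub>i\<^sub>j\<close> has the value
  \<open>\<Sum> Tr (u\<^sub>i\<^sub>j\<^sup>* u\<^sub>j\<^sub>i)\<close>. If it were close to \<open>-3 m\<close>, then in the Hilbert--Schmidt norm the
  unitary would nearly be a direct sum whose first summand is an antisymmetric \<open>3 \<times> 3\<close> block
  matrix with entries \<open>a, b, c\<close> above the diagonal. Orthogonality of its columns gives
  \<open>a\<^sup>* b = a\<^sup>* c = b\<^sup>* c = 0\<close>, while its first row gives \<open>a a\<^sup>* + b b\<^sup>* = 1\<close>; hence
  \<open>c\<^sup>* c = c\<^sup>* (a a\<^sup>* + b b\<^sup>*) c = 0\<close>, and likewise \<open>a = b = 0\<close>, which is absurd. Made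
  quantitative, this keeps the real part of the functional above \<open>-3 m + 3 m / 730\<close> on all automorphisms,
  hence on their convex hull.
\<close>

section \<open>Trace and Hilbert--Schmidt norm\<close>

lemma mat_adjoint_carrier [simp]: "A \<in> carrier_mat a b \<Longrightarrow> mat_adjoint A \<in> carrier_mat b a"
  unfolding mat_adjoint_def by auto

lemma mat_adjoint_index [simp]:
  fixes A :: "complex mat"
  shows "i < dim_col A \<Longrightarrow> j < dim_row A \<Longrightarrow> mat_adjoint A $$ (i, j) = cnj (A $$ (j, i))"
  unfolding mat_adjoint_def by (simp add: mat_of_rows_index)

lemma mat_adjoint_dims [simp]: "dim_row (mat_adjoint A) = dim_col A" "dim_col (mat_adjoint A) = dim_row A"
  unfolding mat_adjoint_def by auto

lemma mat_adjoint_adjoint [simp]: "mat_adjoint (mat_adjoint A) = (A :: complex mat)"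
  by (intro eq_matI) auto

lemma mat_adjoint_add:
  fixes A B :: "complex mat"
  assumes "A \<in> carrier_mat a b" "B \<in> carrier_mat a b"
  shows "mat_adjoint (A + B) = mat_adjoint A + mat_adjoint B"
  using assms by (intro eq_matI) auto

lemma mat_adjoint_mult:
  fixes A B :: "complex mat"
  assumes "A \<in> carrier_mat a b" "B \<in> carrier_mat b c"
  shows "mat_adjoint (A * B) = mat_adjoint B * mat_adjoint A"
  using assms by (intro eq_matI) (auto simp: scalar_prod_def intro!: sum.cong)

definition mat_trace :: "complex mat \<Rightarrow> complex" where
  "mat_trace A = (\<Sum>i<dim_row A. A $$ (i, i))"

lemma mat_trace_add:
  assumes "A \<in> carrier_mat N N" "B \<in> carrier_mat N N"
  shows "mat_trace (A + B) = mat_trace A + mat_trace B"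
  using assms by (simp add: mat_trace_def sum.distrib)

lemma mat_trace_mult:
  assumes "A \<in> carrier_mat N M" "B \<in> carrier_mat M N"
  shows "mat_trace (A * B) = (\<Sum>i<N. \<Sum>j<M. A $$ (i, j) * B $$ (j, i))"
  using assms by (auto simp: mat_trace_def scalar_prod_def atLeast0LessThan intro!: sum.cong)

lemma mat_trace_comm:
  assumes "A \<in> carrier_mat N M" "B \<in> carrier_mat M N"
  shows "mat_trace (A * B) = mat_trace (B * A)"
  unfolding mat_trace_mult[OF assms] mat_trace_mult[OF assms(2,1)]
  by (subst sum.swap) (simp add: mult.commute)

lemma mat_trace_adjoint:
  assumes "A \<in> carrier_mat N N"
  shows "mat_trace (mat_adjoint A) = cnj (mat_trace A)"
  using assms by (auto simp: mat_trace_def)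

definition hs_norm :: "complex mat \<Rightarrow> real" where
  "hs_norm A = L2_set (\<lambda>ij. cmod (A $$ ij)) ({..<dim_row A} \<times> {..<dim_col A})"

lemma hs_norm_nonneg [simp]: "0 \<le> hs_norm A"
  unfolding hs_norm_def by simp

lemma hs_norm_sq:
  assumes "A \<in> carrier_mat N N"
  shows "(hs_norm A)\<^sup>2 = Re (mat_trace (mat_adjoint A * A))"
proof -
  have "(hs_norm A)\<^sup>2 = (\<Sum>i<N. \<Sum>j<N. (cmod (A $$ (i, j)))\<^sup>2)"
    using assms unfolding hs_norm_def L2_set_def
    by (auto simp: sum_nonneg sum.cartesian_product split_def)
  also have "\<dots> = (\<Sum>j<N. \<Sum>i<N. Re (cnj (A $$ (i, j)) * A $$ (i, j)))"
    by (subst sum.swap, intro sum.cong refl) (simp add: cmod_power2 power2_eq_square[of "Re _"] power2_eq_square[of "Im _"])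
  also have "\<dots> = Re (mat_trace (mat_adjoint A * A))"
    using assms by (subst mat_trace_mult[of _ N N]) (auto intro!: sum.cong)
  finally show ?thesis .
qed

lemma hs_norm_triangle:
  assumes "A \<in> carrier_mat N N" "B \<in> carrier_mat N N"
  shows "hs_norm (A + B) \<le> hs_norm A + hs_norm B"
proof -
  let ?I = "{..<N} \<times> {..<N}"
  have "hs_norm (A + B) = L2_set (\<lambda>ij. cmod (A $$ ij + B $$ ij)) ?I"
    unfolding hs_norm_def by (rule L2_set_cong) (use assms in auto)
  also have "\<dots> \<le> L2_set (\<lambda>ij. cmod (A $$ ij) + cmod (B $$ ij)) ?I"
    by (intro L2_set_mono) (auto simp: norm_triangle_ineq)
  also have "\<dots> \<le> hs_norm A + hs_norm B"
    using assms L2_set_triangle_ineq[of "\<lambda>ij. cmod (A $$ ij)" "\<lambda>ij. cmod (B $$ ij)" ?I]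
    unfolding hs_norm_def by simp
  finally show ?thesis .
qed

lemma hs_norm_uminus:
  assumes "A \<in> carrier_mat N N"
  shows "hs_norm (- A) = hs_norm A"
proof -
  have "L2_set (\<lambda>ij. cmod ((- A) $$ ij)) ({..<N} \<times> {..<N}) = L2_set (\<lambda>ij. cmod (A $$ ij)) ({..<N} \<times> {..<N})"
    using assms by (intro L2_set_cong) auto
  then show ?thesis using assms unfolding hs_norm_def by simp
qed

lemma hs_norm_adjoint:
  assumes "A \<in> carrier_mat N N"
  shows "hs_norm (mat_adjoint A) = hs_norm A"
proof -
  have "(hs_norm (mat_adjoint A))\<^sup>2 = (hs_norm A)\<^sup>2"
    using assms by (simp add: hs_norm_sq[of _ N] mat_trace_comm[of A N N])
  then show ?thesis by simp
qed

lemma hs_norm_zero [simp]: "hs_norm (0\<^sub>m N N) = 0"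
  unfolding hs_norm_def by (rule L2_set_0') auto

lemma mat_trace_minus:
  assumes "A \<in> carrier_mat N N" "B \<in> carrier_mat N N"
  shows "mat_trace (A - B) = mat_trace A - mat_trace B"
  using assms by (simp add: mat_trace_def sum_subtractf)

lemma mat_adjoint_minus:
  fixes A B :: "complex mat"
  assumes "A \<in> carrier_mat a b" "B \<in> carrier_mat a b"
  shows "mat_adjoint (A - B) = mat_adjoint A - mat_adjoint B"
  using assms by (intro eq_matI) auto

lemma mat_adjoint_one [simp]: "mat_adjoint (1\<^sub>m N) = (1\<^sub>m N :: complex mat)"
  by (intro eq_matI) auto

text \<open>The left-hand sides of these rules leave some dimensions undetermined; fixing all of
  them to one \<open>N\<close> lets the simplifier discharge the carrier conditions. The rules
  expand sums and nest products to the right.\<close>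

lemmas square_mat_simps =
  mult_carrier_mat[of _ N N _ N] add_carrier_mat[of _ N N] minus_carrier_mat[of _ N N]
  mat_adjoint_carrier[of _ N N] mat_adjoint_mult[of _ N N _ N] mat_adjoint_add[of _ N N]
  mat_adjoint_minus[of _ N N] mat_trace_add[of _ N] mat_trace_minus[of _ N]
  assoc_mult_mat[of _ N N _ N _ N]
  add_mult_distrib_mat[of _ N N _ _ N] mult_add_distrib_mat[of _ N N _ N]
  minus_mult_distrib_mat[of _ N N _ _ N] mult_minus_distrib_mat[of _ N N _ N]
  for N

lemma hs_norm_add_sq:
  assumes A: "A \<in> carrier_mat N N" and B: "B \<in> carrier_mat N N"
  shows "(hs_norm (A + B))\<^sup>2 = (hs_norm A)\<^sup>2 + (hs_norm B)\<^sup>2 + 2 * Re (mat_trace (mat_adjoint A * B))"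
proof -
  have "Re (mat_trace (mat_adjoint B * A)) = Re (mat_trace (mat_adjoint (mat_adjoint A * B)))"
    using A B by (simp add: square_mat_simps[where N = N])
  also have "\<dots> = Re (mat_trace (mat_adjoint A * B))"
    using A B by (subst mat_trace_adjoint[of _ N]) auto
  finally show ?thesis
    using A B by (simp add: hs_norm_sq[of _ N] square_mat_simps[where N = N])
qed

text \<open>The triangle inequality in the form used for the estimates below: one summand is
  isolated from an identity with a known right-hand side.\<close>

lemma hs_norm_le_of_add_eq:
  assumes "A \<in> carrier_mat N N" "B \<in> carrier_mat N N" "A + B = C"
  shows "hs_norm A \<le> hs_norm B + hs_norm C"
proof -
  have C: "C \<in> carrier_mat N N"
    using assms by auto
  have "A = C + (- B)"
    using assms by (intro eq_matI) auto
  then have "hs_norm A \<le> hs_norm C + hs_norm (- B)"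
    using hs_norm_triangle[OF C, of "- B"] assms(2) by simp
  then show ?thesis
    using hs_norm_uminus[OF assms(2)] by simp
qed

section \<open>Partial isometries as contractions of the Hilbert-Schmidt norm\<close>

definition partial_isometry :: "nat \<Rightarrow> complex mat \<Rightarrow> bool" where
  "partial_isometry N w \<longleftrightarrow> w \<in> carrier_mat N N \<and> w * (mat_adjoint w * w) = w"

text \<open>Pythagoras for the projection \<open>h = mat_adjoint w * w\<close>: the squared norm of
  \<open>A\<close> exceeds that of \<open>w * A\<close> by the squared norm of
  \<open>A - h * A\<close>.\<close>

lemma hs_norm_partial_isometry_left:
  assumes w: "partial_isometry N w" and A: "A \<in> carrier_mat N N"
  shows "hs_norm (w * A) \<le> hs_norm A"
proof -
  have wc: "w \<in> carrier_mat N N" and ww: "w * (mat_adjoint w * w) = w"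
    using w by (auto simp: partial_isometry_def)
  define h where "h = mat_adjoint w * w"
  define B where "B = h * A"
  have h: "h \<in> carrier_mat N N" "mat_adjoint h = h" "h * h = h"
    unfolding h_def using wc ww
    by (simp_all add: square_mat_simps[where N = N])
  have B: "B \<in> carrier_mat N N"
    using h A by (simp add: B_def)
  have hB: "mat_adjoint B * B = mat_adjoint A * B" "mat_adjoint B * A = mat_adjoint A * B"
  proof -
    have "h * B = B"
      using h A by (simp add: B_def flip: assoc_mult_mat[of h N N h N A N])
    then show "mat_adjoint B * B = mat_adjoint A * B" "mat_adjoint B * A = mat_adjoint A * B"
      using h(1,2) A B by (simp_all add: B_def square_mat_simps[where N = N])
  qed
  have "mat_adjoint (A - B) * (A - B) = mat_adjoint A * A - mat_adjoint A * B - (mat_adjoint A * B - mat_adjoint A * B)"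
    using A B by (simp add: square_mat_simps[where N = N] hB)
  then have "(hs_norm (A - B))\<^sup>2 = (hs_norm A)\<^sup>2 - Re (mat_trace (mat_adjoint A * B))"
    using A B by (simp add: hs_norm_sq[of _ N] square_mat_simps[where N = N] del: minus_r_inv_mat)
  moreover have "(hs_norm (w * A))\<^sup>2 = Re (mat_trace (mat_adjoint A * B))"
    unfolding B_def h_def using A wc
    by (simp add: hs_norm_sq[of _ N] mat_adjoint_mult[of _ N N _ N] assoc_mult_mat[of _ N N _ N _ N])
  ultimately have "(hs_norm (w * A))\<^sup>2 \<le> (hs_norm A)\<^sup>2"
    using zero_le_power2[of "hs_norm (A - B)"] by linarith
  then show ?thesis by (rule power2_le_imp_le) simp
qed

lemma partial_isometry_adjoint:
  assumes "partial_isometry N w"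
  shows "partial_isometry N (mat_adjoint w)"
proof -
  have wc: "w \<in> carrier_mat N N" and ww: "w * (mat_adjoint w * w) = w"
    using assms by (auto simp: partial_isometry_def)
  have "mat_adjoint w = mat_adjoint (w * (mat_adjoint w * w))"
    by (simp add: ww)
  also have "\<dots> = mat_adjoint w * (w * mat_adjoint w)"
    using wc by (simp only: square_mat_simps[where N = N] mat_adjoint_adjoint)
  finally show ?thesis
    using wc by (simp add: partial_isometry_def)
qed

lemma hs_norm_partial_isometry_right:
  assumes w: "partial_isometry N w" and A: "A \<in> carrier_mat N N"
  shows "hs_norm (A * w) \<le> hs_norm A"
proof -
  have wc: "w \<in> carrier_mat N N"
    using w by (auto simp: partial_isometry_def)
  have "hs_norm (A * w) = hs_norm (mat_adjoint w * mat_adjoint A)"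
    using A wc hs_norm_adjoint[of "A * w" N] by (simp add: mat_adjoint_mult[of _ N N _ N])
  also have "\<dots> \<le> hs_norm A"
    using A hs_norm_partial_isometry_left[OF partial_isometry_adjoint[OF w], of "mat_adjoint A"]
    by (simp add: hs_norm_adjoint[of _ N])
  finally show ?thesis .
qed

section \<open>Two systems of matrix units\<close>

text \<open>The three diagonal units need not sum to the identity; for \<open>n > 3\<close> the
  complementary projection \<open>rest\<close> is nonzero when \<open>m > 0\<close>.\<close>

locale matrix_units3 =
  fixes N :: nat and m :: real and e :: "nat \<Rightarrow> nat \<Rightarrow> complex mat"
  assumes carrier [simp]: "i < 3 \<Longrightarrow> j < 3 \<Longrightarrow> e i j \<in> carrier_mat N N"
    and mult: "i < 3 \<Longrightarrow> j < 3 \<Longrightarrow> k < 3 \<Longrightarrow> l < 3 \<Longrightarrow>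
      e i j * e k l = (if j = k then e i l else 0\<^sub>m N N)"
    and adjoint [simp]: "i < 3 \<Longrightarrow> j < 3 \<Longrightarrow> mat_adjoint (e i j) = e j i"
    and trace: "i < 3 \<Longrightarrow> mat_trace (e i i) = of_real m"
begin

definition rest :: "complex mat" where
  "rest = 1\<^sub>m N - (e 0 0 + (e 1 1 + e 2 2))"

lemma mult_assoc:
  assumes "i < 3" "j < 3" "k < 3" "l < 3" "A \<in> carrier_mat N N"
  shows "e i j * (e k l * A) = (if j = k then e i l * A else 0\<^sub>m N N)"
  using assms mult[of i j k l] by (simp add: assoc_mult_mat[of _ N N _ N _ N, symmetric])

lemma partial_isometry: "i < 3 \<Longrightarrow> j < 3 \<Longrightarrow> partial_isometry N (e i j)"
  by (simp add: partial_isometry_def mult)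

lemma rest_carrier [simp]: "rest \<in> carrier_mat N N"
  unfolding rest_def by (intro minus_carrier_mat add_carrier_mat) auto

lemma rest_adjoint [simp]: "mat_adjoint rest = rest"
  unfolding rest_def by (simp add: mat_adjoint_minus[of _ N N] mat_adjoint_add[of _ N N])

lemma rest_idem: "rest * rest = rest"
proof -
  have "s * s = s" if "s = e 0 0 + (e 1 1 + e 2 2)" for s
    unfolding that
    by (simp add: add_mult_distrib_mat[of _ N N _ _ N] mult_add_distrib_mat[of _ N N _ N] mult)
  moreover have "(1\<^sub>m N - s) * (1\<^sub>m N - s) = 1\<^sub>m N - s" if "s * s = s" "s \<in> carrier_mat N N" for s :: "complex mat"
  proof -
    have "(1\<^sub>m N - s) * (1\<^sub>m N - s) = 1\<^sub>m N - s - (s - s * s)"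
      using that by (simp add: square_mat_simps[where N = N] del: minus_r_inv_mat)
    also have "\<dots> = 1\<^sub>m N - s"
      unfolding that(1) using that(2) by (intro eq_matI) auto
    finally show ?thesis .
  qed
  ultimately show ?thesis
    unfolding rest_def by simp
qed

lemma partial_isometry_rest: "partial_isometry N rest"
  by (simp add: partial_isometry_def rest_idem)

text \<open>The four projections sum to the identity. The order of the indices is left free because
  the later estimates assign the three indices different roles.\<close>

lemma resolution:
  assumes A: "A \<in> carrier_mat N N" and "i < 3" "j < 3" "k < 3" "i \<noteq> j" "i \<noteq> k" "j \<noteq> k"
  shows "e i i * A + (e j j * A + (e k k * A + rest * A)) = A"
proof -
  have dims: "dim_row (e x y) = N" "dim_col (e x y) = N" if "x < 3" "y < 3" for x y
    using carrier[OF that] by auto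
  have *: "e 0 0 + (e 1 1 + (e 2 2 + rest)) = 1\<^sub>m N"
    unfolding rest_def by (intro eq_matI) (auto simp: dims)
  have cases: "x = 0 \<or> x = 1 \<or> x = 2" if "x < 3" for x :: nat
    using that by linarith
  have "e i i + (e j j + (e k k + rest)) = 1\<^sub>m N"
    using cases[OF assms(2)] cases[OF assms(3)] cases[OF assms(4)] assms(5-7)
    unfolding *[symmetric]
    by (elim disjE) (simp_all, (intro eq_matI; simp add: dims)+)
  then have "(e i i + (e j j + (e k k + rest))) * A = A"
    using A by simp
  then show ?thesis
    using assms by (simp add: add_mult_distrib_mat[of _ N N _ _ N])
qed

end

lemma sum_lessThan_3: "(\<Sum>i<3. h i) = h 0 + h 1 + h (2::nat)"
  by (simp add: numeral_3_eq_3 numeral_2_eq_2)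

section \<open>Blocks of one system relative to another, and the defect as a sum of squares\<close>

locale matrix_units3_pair = E: matrix_units3 N m e + F: matrix_units3 N m f for N m e f
begin

abbreviation g :: "nat \<Rightarrow> nat \<Rightarrow> complex mat" where
  "g i j \<equiv> e 0 i * f j 0"

text \<open>If \<open>e = u\<^sup>* f u\<close> for a unitary \<open>u\<close>, then \<open>g i j\<close> is, up to unitary equivalence, the
  \<open>(i, j)\<close> block of \<open>u\<close> with respect to \<open>f\<close>; working with \<open>g\<close> avoids constructing \<open>u\<close>.
  The defect measures how far the upper left part of \<open>u\<close> is from being antisymmetric.\<close>

definition defect :: real where
  "defect = 3 * m + (\<Sum>i<3. \<Sum>j<3. Re (mat_trace (e i j * f i j)))"

lemmas sq = square_mat_simps[where N = N]

text \<open>The auxiliary index 0 cancels by cyclicity of the trace. This turns inner products of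
  blocks into the traces that occur in \<open>defect\<close>.\<close>

lemma trace_g:
  assumes "i < 3" "j < 3" "k < 3" "l < 3"
  shows "mat_trace (mat_adjoint (g i j) * g k l) = mat_trace (e i k * f l j)"
proof -
  have "mat_trace (mat_adjoint (g i j) * g k l) = mat_trace (f 0 j * (e i k * f l 0))"
    using assms by (simp add: sq E.mult_assoc)
  also have "\<dots> = mat_trace (e i k * f l 0 * f 0 j)"
    using assms by (intro mat_trace_comm[of _ N N]) (auto simp: sq)
  also have "\<dots> = mat_trace (e i k * f l j)"
    using assms by (simp add: sq F.mult)
  finally show ?thesis .
qed

lemma hs_norm_g_sq:
  assumes "i < 3" "j < 3"
  shows "(hs_norm (g i j))\<^sup>2 = Re (mat_trace (e i i * f j j))"
proof -
  have "(hs_norm (g i j))\<^sup>2 = Re (mat_trace (mat_adjoint (g i j) * g i j))"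
    using assms by (intro hs_norm_sq[of _ N]) (auto simp: sq)
  then show ?thesis
    unfolding trace_g[OF assms assms] .
qed

lemma hs_norm_g_add_sq:
  assumes "i < 3" "j < 3"
  shows "(hs_norm (g i j + g j i))\<^sup>2 = Re (mat_trace (e i i * f j j)) + Re (mat_trace (e j j * f i i))
    + 2 * Re (mat_trace (e i j * f i j))"
proof -
  have "(hs_norm (g i j + g j i))\<^sup>2 = (hs_norm (g i j))\<^sup>2 + (hs_norm (g j i))\<^sup>2
      + 2 * Re (mat_trace (mat_adjoint (g i j) * g j i))"
    using assms by (intro hs_norm_add_sq[of _ N]) (auto simp: sq)
  then show ?thesis
    unfolding trace_g[OF assms assms(2,1)] hs_norm_g_sq[OF assms] hs_norm_g_sq[OF assms(2,1)] .
qed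

text \<open>Column \<open>j\<close> has total mass \<open>mat_trace (f j j) = m\<close>; the part in
  \<open>rest\<close> is what the three rows leave over.\<close>

lemma hs_norm_rest_sq:
  assumes "j < 3"
  shows "(hs_norm (E.rest * f j j))\<^sup>2 = m - (\<Sum>i<3. Re (mat_trace (e i i * f j j)))"
proof -
  have "mat_trace (mat_adjoint (E.rest * f j j) * (E.rest * f j j)) = mat_trace (f j j * (E.rest * f j j))"
    using assms by (simp add: sq E.rest_idem flip: assoc_mult_mat[of E.rest N N E.rest N "f j j" N])
  also have "\<dots> = mat_trace (E.rest * f j j * f j j)"
    using assms by (intro mat_trace_comm[of _ N N]) (auto simp: sq)
  also have "\<dots> = mat_trace (E.rest * f j j)"
    using assms by (simp add: sq F.mult)
  also have "\<dots> = of_real m - (\<Sum>i<3. mat_trace (e i i * f j j))"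
    using assms by (simp add: E.rest_def sq left_mult_one_mat[of _ N N] F.trace sum_lessThan_3)
  finally show ?thesis
    using assms by (simp add: hs_norm_sq[of _ N] sq)
qed

text \<open>Expanding the squares of \<open>g i j + g j i\<close> yields twice the functional plus
  twice the sum of all \<open>Re (mat_trace (e i i * f j j))\<close>. The \<open>rest\<close> terms
  contribute \<open>6 * m\<close> minus that same sum doubled, so it cancels. Consequently
  \<open>defect\<close> controls every square on the right.\<close>

lemma defect_eq:
  "2 * defect = (\<Sum>i<3. \<Sum>j<3. (hs_norm (g i j + g j i))\<^sup>2) + 2 * (\<Sum>j<3. (hs_norm (E.rest * f j j))\<^sup>2)"
  unfolding defect_def by (simp add: hs_norm_g_add_sq hs_norm_rest_sq sum_lessThan_3)

lemma defect_nonneg: "0 \<le> defect"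
proof -
  have "0 \<le> 2 * defect"
    unfolding defect_eq by (intro add_nonneg_nonneg mult_nonneg_nonneg sum_nonneg) auto
  then show ?thesis by simp
qed

section \<open>Blocks that are small directly by the defect\<close>

lemma hs_norm_rest_le:
  assumes "j < 3"
  shows "hs_norm (E.rest * f j j) \<le> sqrt defect"
proof -
  have "(hs_norm (E.rest * f j j))\<^sup>2 \<le> (\<Sum>j<3. (hs_norm (E.rest * f j j))\<^sup>2)"
    using assms by (intro member_le_sum) auto
  moreover have "0 \<le> (\<Sum>i<3. \<Sum>j<3. (hs_norm (g i j + g j i))\<^sup>2)"
    by (intro sum_nonneg) auto
  ultimately show ?thesis
    using defect_eq by (intro real_le_rsqrt) linarith
qed

lemma hs_norm_g_add_le:
  assumes "i < 3" "j < 3" "i \<noteq> j"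
  shows "hs_norm (g i j + g j i) \<le> sqrt defect"
proof -
  define G where "G = (\<lambda>(i, j). (hs_norm (g i j + g j i))\<^sup>2)"
  \<comment> \<open>Both orderings of the pair occur in the double sum, which compensates for the
    factor 2 in \<open>defect_eq\<close>.\<close>
  have "G (i, j) + G (j, i) = (\<Sum>ij\<in>{(i, j), (j, i)}. G ij)"
    using assms by simp
  also have "\<dots> \<le> (\<Sum>ij\<in>{..<3} \<times> {..<3}. G ij)"
    using assms by (intro sum_mono2) (auto simp: G_def)
  also have "\<dots> = (\<Sum>i<3. \<Sum>j<3. (hs_norm (g i j + g j i))\<^sup>2)"
    by (simp add: G_def sum.cartesian_product)
  finally have "G (i, j) + G (j, i) \<le> 2 * defect"
    unfolding defect_eq using sum_nonneg[of "{..<3}" "\<lambda>j. (hs_norm (E.rest * f j j))\<^sup>2"] by simp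
  moreover have "G (j, i) = G (i, j)"
    unfolding G_def using assms
    by (simp add: comm_add_mat[of "g i j" N N "g j i"] sq)
  ultimately show ?thesis
    unfolding G_def by (intro real_le_rsqrt) simp
qed

lemma hs_norm_g_diag_le:
  assumes "i < 3"
  shows "hs_norm (e i i * f i i) \<le> sqrt defect"
proof -
  have "(hs_norm (g i i + g i i))\<^sup>2 \<le> (\<Sum>j<3. (hs_norm (g i j + g j i))\<^sup>2)"
    using assms by (intro member_le_sum[of i "{..<3}" "\<lambda>j. (hs_norm (g i j + g j i))\<^sup>2"]) auto
  also have "\<dots> \<le> (\<Sum>i<3. \<Sum>j<3. (hs_norm (g i j + g j i))\<^sup>2)"
    using assms by (intro member_le_sum[of i "{..<3}" "\<lambda>i. \<Sum>j<3. (hs_norm (g i j + g j i))\<^sup>2"]) (auto intro: sum_nonneg)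
  also have "\<dots> \<le> 2 * defect"
    unfolding defect_eq using sum_nonneg[of "{..<3}" "\<lambda>j. (hs_norm (E.rest * f j j))\<^sup>2"] by simp
  \<comment> \<open>For equal indices the square is that of \<open>2 * g i i\<close>, hence the
    factor 4. The resulting bound \<open>defect / 2\<close> is relaxed to \<open>defect\<close> to
    have one constant throughout.\<close>
  finally have "4 * Re (mat_trace (e i i * f i i)) \<le> 2 * defect"
    using assms by (simp add: hs_norm_g_add_sq)
  moreover have "(hs_norm (e i i * f i i))\<^sup>2 = Re (mat_trace (e i i * f i i))"
  proof -
    have "mat_trace (mat_adjoint (e i i * f i i) * (e i i * f i i)) = mat_trace (f i i * (e i i * f i i))"
      using assms by (simp add: sq E.mult_assoc)
    also have "\<dots> = mat_trace (e i i * f i i * f i i)"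
      using assms by (intro mat_trace_comm[of _ N N]) (auto simp: sq)
    also have "\<dots> = mat_trace (e i i * f i i)"
      using assms by (simp add: sq F.mult)
    finally show ?thesis
      using assms by (simp add: hs_norm_sq[of _ N] sq)
  qed
  ultimately show ?thesis
    using defect_nonneg by (intro real_le_rsqrt) simp
qed

text \<open>Cyclicity of the trace makes \<open>defect\<close> symmetric in the two systems, so the
  estimate for columns, applied with \<open>e\<close> and \<open>f\<close> exchanged, gives the one
  for rows.\<close>

lemma hs_norm_rest_le':
  assumes "j < 3"
  shows "hs_norm (F.rest * e j j) \<le> sqrt defect"
proof -
  interpret swap: matrix_units3_pair N m f e ..
  have "mat_trace (f i j * e i j) = mat_trace (e i j * f i j)" if "i < 3" "j < 3" for i j
    using that by (intro mat_trace_comm[of _ N N]) auto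
  then have "swap.defect = defect"
    unfolding swap.defect_def defect_def by simp
  then show ?thesis
    using swap.hs_norm_rest_le[OF assms] by simp
qed

section \<open>Approximate orthogonality relations and smallness of all blocks\<close>

lemma hs_norm_left_le:
  assumes "i < 3" "j < 3" "A \<in> carrier_mat N N"
  shows "hs_norm (e i j * A) \<le> hs_norm A" "hs_norm (f i j * A) \<le> hs_norm A"
  using assms by (auto intro: hs_norm_partial_isometry_left E.partial_isometry F.partial_isometry)

lemma hs_norm_right_le:
  assumes "i < 3" "j < 3" "A \<in> carrier_mat N N"
  shows "hs_norm (A * e i j) \<le> hs_norm A" "hs_norm (A * f i j) \<le> hs_norm A"
  using assms by (auto intro: hs_norm_partial_isometry_right E.partial_isometry F.partial_isometry)

text \<open>Here \<open>f 0 j * (e i k * f l 0)\<close> is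
  \<open>mat_adjoint (g i j) * g k l\<close>, which is \<open>u_ij^* u_kl\<close> in terms of the
  blocks of the unitary \<open>u\<close>. Replacing \<open>u_ij\<close> by \<open>- u_ji\<close>
  costs \<open>sqrt defect\<close>, since the remaining factors are contractions.\<close>

lemma hs_norm_swap_le:
  assumes "i < 3" "j < 3" "k < 3" "l < 3" "i \<noteq> j"
  shows "hs_norm (f 0 j * (e i k * f l 0)) \<le> hs_norm (f 0 i * (e j k * f l 0)) + sqrt defect"
proof -
  have "f 0 j * (e i k * f l 0) + f 0 i * (e j k * f l 0) = mat_adjoint (g i j + g j i) * e 0 k * f l 0"
    using assms by (simp add: sq E.mult_assoc)
  then have "hs_norm (f 0 j * (e i k * f l 0))
      \<le> hs_norm (f 0 i * (e j k * f l 0)) + hs_norm (mat_adjoint (g i j + g j i) * e 0 k * f l 0)"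
    using assms by (intro hs_norm_le_of_add_eq[of _ N]) (auto simp: sq)
  also have "hs_norm (mat_adjoint (g i j + g j i) * e 0 k * f l 0) \<le> hs_norm (mat_adjoint (g i j + g j i) * e 0 k)"
    using assms by (intro hs_norm_right_le) (auto simp: sq)
  also have "\<dots> \<le> hs_norm (mat_adjoint (g i j + g j i))"
    using assms by (intro hs_norm_right_le) (auto simp: sq)
  also have "\<dots> = hs_norm (g i j + g j i)"
    using assms by (intro hs_norm_adjoint[of _ N]) (auto simp: sq)
  also have "\<dots> \<le> sqrt defect"
    using assms by (intro hs_norm_g_add_le)
  finally show ?thesis by simp
qed

text \<open>Columns \<open>i\<close> and \<open>k\<close> of \<open>u\<close> are orthogonal. In
  this relation the terms of rows \<open>i\<close> and \<open>k\<close> contain a diagonal block and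
  the remaining rows form the \<open>rest\<close> term; each has norm at most
  \<open>sqrt defect\<close>, so the term \<open>u_ji^* u_jk\<close> of row \<open>j\<close> has
  norm at most three times that.\<close>

lemma hs_norm_off_diag_le:
  assumes "i < 3" "j < 3" "k < 3" "i \<noteq> j" "i \<noteq> k" "j \<noteq> k"
  shows "hs_norm (f 0 i * (e j j * f k 0)) \<le> 3 * sqrt defect"
proof -
  have "f 0 i * (e j j * f k 0) + (f 0 i * (e i i * f k 0) + (f 0 i * (e k k * f k 0) + f 0 i * (E.rest * f k 0)))
      = f 0 i * (e j j * f k 0 + (e i i * f k 0 + (e k k * f k 0 + E.rest * f k 0)))"
    using assms by (simp add: sq)
  also have "\<dots> = 0\<^sub>m N N"
    using assms by (simp add: E.resolution F.mult)
  finally have "hs_norm (f 0 i * (e j j * f k 0))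
      \<le> hs_norm (f 0 i * (e i i * f k 0) + (f 0 i * (e k k * f k 0) + f 0 i * (E.rest * f k 0))) + hs_norm (0\<^sub>m N N)"
    using assms by (intro hs_norm_le_of_add_eq[of _ N]) (auto simp: sq)
  also have "\<dots> \<le> hs_norm (f 0 i * (e i i * f k 0)) + (hs_norm (f 0 i * (e k k * f k 0)) + hs_norm (f 0 i * (E.rest * f k 0)))"
    using assms hs_norm_triangle[of "f 0 i * (e i i * f k 0)" N "f 0 i * (e k k * f k 0) + f 0 i * (E.rest * f k 0)"]
      hs_norm_triangle[of "f 0 i * (e k k * f k 0)" N "f 0 i * (E.rest * f k 0)"]
    by (simp add: sq)
  also have "hs_norm (f 0 i * (e i i * f k 0)) \<le> sqrt defect"
  proof -
    have "hs_norm (f 0 i * (e i i * f k 0)) = hs_norm (f 0 i * (f i i * e i i) * f k 0)"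
      using assms by (simp add: sq F.mult_assoc)
    also have "\<dots> \<le> hs_norm (f 0 i * (f i i * e i i))"
      using assms by (intro hs_norm_right_le) (auto simp: sq)
    also have "\<dots> \<le> hs_norm (f i i * e i i)"
      using assms by (intro hs_norm_left_le) (auto simp: sq)
    also have "\<dots> = hs_norm (mat_adjoint (e i i * f i i))"
      using assms by (simp add: sq)
    also have "\<dots> = hs_norm (e i i * f i i)"
      using assms by (intro hs_norm_adjoint[of _ N]) (auto simp: sq)
    also have "\<dots> \<le> sqrt defect"
      using assms by (intro hs_norm_g_diag_le)
    finally show ?thesis .
  qed
  also have "hs_norm (f 0 i * (e k k * f k 0)) \<le> sqrt defect"
  proof -
    have "hs_norm (f 0 i * (e k k * f k 0)) = hs_norm (f 0 i * (e k k * f k k * f k 0))"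
      using assms by (simp add: sq F.mult)
    also have "\<dots> \<le> hs_norm (e k k * f k k * f k 0)"
      using assms by (intro hs_norm_left_le) (auto simp: sq)
    also have "\<dots> \<le> hs_norm (e k k * f k k)"
      using assms by (intro hs_norm_right_le) (auto simp: sq)
    also have "\<dots> \<le> sqrt defect"
      using assms by (intro hs_norm_g_diag_le)
    finally show ?thesis .
  qed
  also have "hs_norm (f 0 i * (E.rest * f k 0)) \<le> sqrt defect"
  proof -
    have "hs_norm (f 0 i * (E.rest * f k 0)) = hs_norm (f 0 i * (E.rest * f k k * f k 0))"
      using assms by (simp add: sq F.mult)
    also have "\<dots> \<le> hs_norm (E.rest * f k k * f k 0)"
      using assms by (intro hs_norm_left_le) (auto simp: sq)
    also have "\<dots> \<le> hs_norm (E.rest * f k k)"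
      using assms by (intro hs_norm_right_le) (auto simp: sq)
    also have "\<dots> \<le> sqrt defect"
      using assms by (intro hs_norm_rest_le)
    finally show ?thesis .
  qed
  finally show ?thesis by simp
qed

text \<open>Passes from the compressions produced by \<open>resolution\<close> to the block products
  estimated above.\<close>

lemma hs_norm_sandwich_le:
  assumes "i < 3" "A \<in> carrier_mat N N" "k < 3"
  shows "hs_norm (f i i * (A * f k k)) \<le> hs_norm (f 0 i * (A * f k 0))"
proof -
  have "hs_norm (f i i * (A * f k k)) = hs_norm (f i 0 * (f 0 i * (A * f k 0) * f 0 k))"
    using assms by (simp add: sq F.mult F.mult_assoc)
  also have "\<dots> \<le> hs_norm (f 0 i * (A * f k 0) * f 0 k)"
    using assms by (intro hs_norm_left_le) (auto simp: sq)
  also have "\<dots> \<le> hs_norm (f 0 i * (A * f k 0))"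
    using assms by (intro hs_norm_right_le) (auto simp: sq)
  finally show ?thesis .
qed

text \<open>Row \<open>a\<close> of \<open>u\<close> resolves the identity, so the block
  \<open>u_bc\<close> is recovered from the products \<open>u_ax^* u_bc\<close>. For
  \<open>x = a\<close> a diagonal block occurs, and the \<open>rest\<close> part is small: cost 1
  each. For \<open>x = b\<close> one swap leads to column orthogonality: cost 1 + 3. For
  \<open>x = c\<close> two swaps are needed: cost 2 + 3. The total is 11.\<close>

lemma hs_norm_mult_le:
  assumes "a < 3" "b < 3" "c < 3" "a \<noteq> b" "a \<noteq> c" "b \<noteq> c"
  shows "hs_norm (e a b * f c c) \<le> 11 * sqrt defect"
proof -
  let ?X = "e a b * f c c"
  have X: "?X \<in> carrier_mat N N"
    using assms by (simp add: sq)
  have "hs_norm ?X = hs_norm (f a a * ?X + (f b b * ?X + (f c c * ?X + F.rest * ?X)))"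
    using F.resolution[OF X, of a b c] assms by simp
  also have "\<dots> \<le> hs_norm (f a a * ?X) + (hs_norm (f b b * ?X) + (hs_norm (f c c * ?X) + hs_norm (F.rest * ?X)))"
    using assms hs_norm_triangle[of "f a a * ?X" N "f b b * ?X + (f c c * ?X + F.rest * ?X)"]
      hs_norm_triangle[of "f b b * ?X" N "f c c * ?X + F.rest * ?X"]
      hs_norm_triangle[of "f c c * ?X" N "F.rest * ?X"]
    by (simp add: sq)
  also have "hs_norm (f a a * ?X) \<le> sqrt defect"
  proof -
    have "hs_norm (f a a * ?X) = hs_norm (f a a * e a a * e a b * f c c)"
      using assms by (simp add: sq E.mult_assoc)
    also have "\<dots> \<le> hs_norm (f a a * e a a * e a b)"
      using assms by (intro hs_norm_right_le) (auto simp: sq)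
    also have "\<dots> \<le> hs_norm (f a a * e a a)"
      using assms by (intro hs_norm_right_le) (auto simp: sq)
    also have "\<dots> = hs_norm (mat_adjoint (e a a * f a a))"
      using assms by (simp add: sq)
    also have "\<dots> = hs_norm (e a a * f a a)"
      using assms by (intro hs_norm_adjoint[of _ N]) (auto simp: sq)
    also have "\<dots> \<le> sqrt defect"
      using assms by (intro hs_norm_g_diag_le)
    finally show ?thesis .
  qed
  also have "hs_norm (F.rest * ?X) \<le> sqrt defect"
  proof -
    have "hs_norm (F.rest * ?X) = hs_norm (F.rest * e a a * e a b * f c c)"
      using assms by (simp add: sq E.mult_assoc)
    also have "\<dots> \<le> hs_norm (F.rest * e a a * e a b)"
      using assms by (intro hs_norm_right_le) (auto simp: sq)
    also have "\<dots> \<le> hs_norm (F.rest * e a a)"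
      using assms by (intro hs_norm_right_le) (auto simp: sq)
    also have "\<dots> \<le> sqrt defect"
      using assms by (intro hs_norm_rest_le')
    finally show ?thesis .
  qed
  also have "hs_norm (f b b * ?X) \<le> 4 * sqrt defect"
  proof -
    have "hs_norm (f b b * ?X) \<le> hs_norm (f 0 b * (e a b * f c 0))"
      using assms by (intro hs_norm_sandwich_le) auto
    also have "\<dots> \<le> hs_norm (f 0 a * (e b b * f c 0)) + sqrt defect"
      using assms by (intro hs_norm_swap_le)
    also have "hs_norm (f 0 a * (e b b * f c 0)) \<le> 3 * sqrt defect"
      using assms by (intro hs_norm_off_diag_le)
    finally show ?thesis by simp
  qed
  also have "hs_norm (f c c * ?X) \<le> 5 * sqrt defect"
  proof -
    have "hs_norm (f c c * ?X) \<le> hs_norm (f 0 c * (e a b * f c 0))"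
      using assms by (intro hs_norm_sandwich_le) auto
    also have "\<dots> \<le> hs_norm (f 0 a * (e c b * f c 0)) + sqrt defect"
      using assms by (intro hs_norm_swap_le)
    \<comment> \<open>Taking the adjoint brings the other block to the front, where antisymmetry can
      be applied to it as well.\<close>
    also have "hs_norm (f 0 a * (e c b * f c 0)) = hs_norm (mat_adjoint (f 0 c * (e b c * f a 0)))"
      using assms by (simp add: sq)
    also have "\<dots> = hs_norm (f 0 c * (e b c * f a 0))"
      using assms by (intro hs_norm_adjoint[of _ N]) (auto simp: sq)
    also have "\<dots> \<le> hs_norm (f 0 b * (e c c * f a 0)) + sqrt defect"
      using assms by (intro hs_norm_swap_le)
    also have "hs_norm (f 0 b * (e c c * f a 0)) \<le> 3 * sqrt defect"
      using assms by (intro hs_norm_off_diag_le) auto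
    finally show ?thesis by simp
  qed
  finally show ?thesis by simp
qed

text \<open>The auxiliary row \<open>a\<close> drops out, so \<open>hs_norm_mult_le\<close> bounds
  the block with indices \<open>b\<close> and \<open>c\<close> itself.\<close>

lemma hs_norm_mult_sq:
  assumes "a < 3" "b < 3" "c < 3"
  shows "(hs_norm (e a b * f c c))\<^sup>2 = Re (mat_trace (e b b * f c c))"
proof -
  have "(hs_norm (e a b * f c c))\<^sup>2 = Re (mat_trace (f c c * (e b b * f c c)))"
    using assms by (simp add: hs_norm_sq[of _ N] sq E.mult_assoc)
  also have "mat_trace (f c c * (e b b * f c c)) = mat_trace (e b b * f c c * f c c)"
    using assms by (intro mat_trace_comm[of _ N N]) (auto simp: sq)
  also have "\<dots> = mat_trace (e b b * f c c)"
    using assms by (simp add: sq F.mult)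
  finally show ?thesis .
qed

text \<open>The constant is \<open>730 = 6 \<cdot> 11\<^sup>2 + 3 + 1\<close>: six off-diagonal and three diagonal entries, and the
  \<open>rest\<close> terms.\<close>

lemma defect_lower_bound: "3 * m \<le> 730 * defect"
proof -
  have off: "Re (mat_trace (e b b * f c c)) \<le> 121 * defect"
    if "a < 3" "b < 3" "c < 3" "a \<noteq> b" "a \<noteq> c" "b \<noteq> c" for a b c
  proof -
    have "(hs_norm (e a b * f c c))\<^sup>2 \<le> (11 * sqrt defect)\<^sup>2"
      using that by (intro power_mono hs_norm_mult_le) auto
    then show ?thesis
      using that defect_nonneg by (simp add: hs_norm_mult_sq power_mult_distrib)
  qed
  have diag: "Re (mat_trace (e a a * f a a)) \<le> defect" if "a < 3" for a
  proof -
    have "(hs_norm (e a a * f a a))\<^sup>2 \<le> (sqrt defect)\<^sup>2"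
      using that by (intro power_mono hs_norm_g_diag_le) auto
    then show ?thesis
      using that defect_nonneg by (simp add: hs_norm_mult_sq)
  qed
  \<comment> \<open>By \<open>hs_norm_rest_sq\<close> this says that \<open>3 * m\<close> exceeds
    the sum of the nine traces by at most \<open>defect\<close>.\<close>
  have "2 * (\<Sum>j<3. (hs_norm (E.rest * f j j))\<^sup>2) \<le> 2 * defect"
    unfolding defect_eq by (simp add: sum_nonneg)
  then show ?thesis
    using off[of 0 1 2] off[of 0 2 1] off[of 1 0 2] off[of 1 2 0] off[of 2 0 1] off[of 2 1 0]
      diag[of 0] diag[of 1] diag[of 2]
    by (simp add: hs_norm_rest_sq sum_lessThan_3)
qed

end

section \<open>Kronecker products and automorphisms\<close>

lemma sum_lessThan_mult:
  fixes h :: "nat \<Rightarrow> 'a :: comm_monoid_add"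
  shows "(\<Sum>r<a * b. h r) = (\<Sum>i<a. \<Sum>p<b. h (i * b + p))"
proof -
  have "sum h {i * b..<i * b + b} = (\<Sum>p<b. h (i * b + p))" for i
    using sum.shift_bounds_nat_ivl[of h 0 "i * b" b] by (simp add: atLeast0LessThan add.commute)
  then show ?thesis
    using sum.nat_group[of h b a] by simp
qed

lemma mult_add_less:
  fixes i p a b :: nat
  assumes "i < a" "p < b"
  shows "i * b + p < a * b"
proof -
  have "i * b + p < Suc i * b" using assms by simp
  also have "\<dots> \<le> a * b" using assms by (intro mult_right_mono) auto
  finally show ?thesis .
qed

lemma kron_carrier [simp]: "kron a b A B \<in> carrier_mat (a * b) (a * b)"
  by (simp add: kron_def)

lemma kron_index:
  assumes "i < a" "j < a" "p < b" "q < b"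
  shows "kron a b A B $$ (i * b + p, j * b + q) = A $$ (i, j) * B $$ (p, q)"
  using assms by (simp add: kron_def mult_add_less)

lemma eq_mat_prodI:
  assumes "X \<in> carrier_mat (a * b) (a * b)" "Y \<in> carrier_mat (a * b) (a * b)"
    and "\<And>i j p q. i < a \<Longrightarrow> j < a \<Longrightarrow> p < b \<Longrightarrow> q < b \<Longrightarrow>
      X $$ (i * b + p, j * b + q) = Y $$ (i * b + p, j * b + q)"
  shows "X = Y"
proof (rule eq_matI)
  fix r s assume "r < dim_row Y" "s < dim_col Y"
  then have rs: "r < a * b" "s < a * b"
    using assms by auto
  then have "b > 0" by (cases b) auto
  then show "X $$ (r, s) = Y $$ (r, s)"
    using assms(3)[of "r div b" "s div b" "r mod b" "s mod b"] rs by (simp add: less_mult_imp_div_less)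
qed (use assms in auto)

lemma kron_mult:
  assumes "A \<in> carrier_mat a a" "C \<in> carrier_mat a a" "B \<in> carrier_mat b b" "D \<in> carrier_mat b b"
  shows "kron a b A B * kron a b C D = kron a b (A * C) (B * D)"
proof (rule eq_mat_prodI[of _ a b])
  fix i j p q assume *: "i < a" "j < a" "p < b" "q < b"
  note ip = mult_add_less[OF *(1,3)] mult_add_less[OF *(2,4)]
  have "(kron a b A B * kron a b C D) $$ (i * b + p, j * b + q)
      = (\<Sum>t<a * b. kron a b A B $$ (i * b + p, t) * kron a b C D $$ (t, j * b + q))"
    using ip by (subst index_mult_mat) (auto simp: kron_def scalar_prod_def atLeast0LessThan)
  also have "\<dots> = (\<Sum>k<a. \<Sum>l<b. (A $$ (i, k) * C $$ (k, j)) * (B $$ (p, l) * D $$ (l, q)))"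
    using * by (simp add: sum_lessThan_mult kron_index) (simp add: mult_ac)
  also have "\<dots> = kron a b (A * C) (B * D) $$ (i * b + p, j * b + q)"
    using * assms by (simp add: kron_index sum_product scalar_prod_def atLeast0LessThan)
  finally show "(kron a b A B * kron a b C D) $$ (i * b + p, j * b + q)
      = kron a b (A * C) (B * D) $$ (i * b + p, j * b + q)" .
qed (auto simp: kron_def)

lemma kron_adjoint:
  assumes "A \<in> carrier_mat a a" "B \<in> carrier_mat b b"
  shows "mat_adjoint (kron a b A B) = kron a b (mat_adjoint A) (mat_adjoint B)"
  by (rule eq_mat_prodI[of _ a b])
    (use assms in \<open>simp_all add: kron_index mult_add_less carrier_matD[OF kron_carrier]\<close>)

lemma kron_zero_left [simp]: "kron a b (0\<^sub>m a a) B = 0\<^sub>m (a * b) (a * b)"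
  by (rule eq_mat_prodI[of _ a b]) (simp_all add: kron_index mult_add_less)

lemma kron_one: "kron a b (1\<^sub>m a) (1\<^sub>m b) = 1\<^sub>m (a * b)"
proof (rule eq_mat_prodI[of _ a b])
  fix i j p q assume *: "i < a" "j < a" "p < b" "q < b"
  have "(i * b + p = j * b + q) = (i = j \<and> p = q)"
  proof
    assume eq: "i * b + p = j * b + q"
    have "i = (i * b + p) div b" "p = (i * b + p) mod b" using * by auto
    then show "i = j \<and> p = q" unfolding eq using * by auto
  qed auto
  then show "kron a b (1\<^sub>m a) (1\<^sub>m b) $$ (i * b + p, j * b + q) = 1\<^sub>m (a * b) $$ (i * b + p, j * b + q)"
    using * by (auto simp: kron_index mult_add_less)
qed auto

lemma mat_trace_kron:
  assumes "A \<in> carrier_mat a a" "B \<in> carrier_mat b b"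
  shows "mat_trace (kron a b A B) = mat_trace A * mat_trace B"
proof -
  have "mat_trace (kron a b A B) = (\<Sum>i<a. \<Sum>p<b. A $$ (i, i) * B $$ (p, p))"
    by (simp add: mat_trace_def carrier_matD[OF kron_carrier] sum_lessThan_mult kron_index)
  then show ?thesis
    using assms by (simp add: mat_trace_def sum_product)
qed

lemma mat_unit_carrier [simp]: "mat_unit N ij \<in> carrier_mat N N"
  by (simp add: mat_unit_def)

lemma mat_unit_mult:
  assumes "j < N" "k < N"
  shows "mat_unit N (i, j) * mat_unit N (k, l) = (if j = k then mat_unit N (i, l) else 0\<^sub>m N N)"
proof (rule eq_matI)
  fix r s assume "r < dim_row (if j = k then mat_unit N (i, l) else 0\<^sub>m N N)"
    "s < dim_col (if j = k then mat_unit N (i, l) else 0\<^sub>m N N)"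
  then have rs: "r < N" "s < N" by (auto simp: mat_unit_def split: if_splits)
  have "(mat_unit N (i, j) * mat_unit N (k, l)) $$ (r, s)
      = (\<Sum>t<N. mat_unit N (i, j) $$ (r, t) * mat_unit N (k, l) $$ (t, s))"
    using rs by (simp add: mat_unit_def scalar_prod_def atLeast0LessThan)
  also have "\<dots> = (\<Sum>t<N. (if t = j then (if r = i \<and> j = k \<and> s = l then 1 else 0) else 0))"
    using rs by (intro sum.cong refl) (auto simp: mat_unit_def)
  finally show "(mat_unit N (i, j) * mat_unit N (k, l)) $$ (r, s)
      = (if j = k then mat_unit N (i, l) else 0\<^sub>m N N) $$ (r, s)"
    using rs assms by (simp add: mat_unit_def)
qed (auto simp: mat_unit_def)

lemma mat_unit_adjoint: "mat_adjoint (mat_unit N (i, j)) = mat_unit N (j, i)"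
  by (intro eq_matI) (auto simp: mat_unit_def)

lemma mat_trace_mat_unit:
  assumes "i < N"
  shows "mat_trace (mat_unit N (i, j)) = (if i = j then 1 else 0)"
proof -
  have "mat_trace (mat_unit N (i, j)) = (\<Sum>t<N. if t = i then (if i = j then 1 else 0) else 0)"
    unfolding mat_trace_def by (auto simp: mat_unit_def intro!: sum.cong)
  then show ?thesis using assms by simp
qed

lemma mat_trace_one [simp]: "mat_trace (1\<^sub>m N) = of_nat N"
  by (simp add: mat_trace_def)

lemma mat_trace_zero [simp]: "mat_trace (0\<^sub>m N N) = 0"
  by (simp add: mat_trace_def)

section \<open>Automorphisms of matrix algebras\<close>

lemma star_automorphismsD:
  assumes "\<phi> \<in> star_automorphisms N"
  shows "mat_linear N N \<phi>"
    and "A \<in> carrier_mat N N \<Longrightarrow> \<phi> A \<in> carrier_mat N N"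
    and "A \<in> carrier_mat N N \<Longrightarrow> B \<in> carrier_mat N N \<Longrightarrow> \<phi> (A * B) = \<phi> A * \<phi> B"
    and "A \<in> carrier_mat N N \<Longrightarrow> \<phi> (mat_adjoint A) = mat_adjoint (\<phi> A)"
    and "\<phi> (0\<^sub>m N N) = 0\<^sub>m N N"
    and "\<phi> (1\<^sub>m N) = 1\<^sub>m N"
proof -
  show lin: "mat_linear N N \<phi>"
    and mult: "A \<in> carrier_mat N N \<Longrightarrow> B \<in> carrier_mat N N \<Longrightarrow> \<phi> (A * B) = \<phi> A * \<phi> B"
    and "A \<in> carrier_mat N N \<Longrightarrow> \<phi> (mat_adjoint A) = mat_adjoint (\<phi> A)" for A B
    using assms by (auto simp: star_automorphisms_def)
  show car: "A \<in> carrier_mat N N \<Longrightarrow> \<phi> A \<in> carrier_mat N N" for A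
    using lin by (auto simp: mat_linear_def)
  have "\<phi> (0\<^sub>m N N) = \<phi> (0 \<cdot>\<^sub>m 0\<^sub>m N N)"
    by simp
  also have "\<dots> = 0 \<cdot>\<^sub>m \<phi> (0\<^sub>m N N)"
    using lin unfolding mat_linear_def by (metis zero_carrier_mat)
  also have "\<dots> = 0\<^sub>m N N"
    using car[of "0\<^sub>m N N"] by (intro eq_matI) auto
  finally show "\<phi> (0\<^sub>m N N) = 0\<^sub>m N N" .
  \<comment> \<open>Unitality comes from surjectivity: multiplying a preimage of the identity by the
    identity does not change its image.\<close>
  obtain Y where Y: "Y \<in> carrier_mat N N" "\<phi> Y = 1\<^sub>m N"
    using assms one_carrier_mat[of N] unfolding star_automorphisms_def bij_betw_def
    by (metis (mono_tags, lifting) imageE mem_Collect_eq)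
  have "\<phi> (1\<^sub>m N) = \<phi> (1\<^sub>m N) * \<phi> Y"
    using car[of "1\<^sub>m N"] Y by simp
  also have "\<dots> = \<phi> (1\<^sub>m N * Y)"
    using Y by (intro mult[symmetric]) auto
  finally show "\<phi> (1\<^sub>m N) = 1\<^sub>m N"
    using Y by simp
qed

text \<open>Uniqueness of the trace: the trace composed with \<open>\<phi>\<close> is again tracial,
  hence a multiple of the trace, and the factor is 1 because \<open>\<phi>\<close> is unital. This
  way no implementing unitary has to be found. Fixing the factor divides by \<open>N\<close>, so
  \<open>N = 0\<close> is treated apart.\<close>

lemma mat_trace_automorphism:
  assumes \<phi>: "\<phi> \<in> star_automorphisms N" and A: "A \<in> carrier_mat N N"
  shows "mat_trace (\<phi> A) = mat_trace A"
proof (cases "N = 0")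
  case True
  then show ?thesis
    using A star_automorphismsD(2)[OF \<phi> A] by (simp add: mat_trace_def)
next
  case False
  note D = star_automorphismsD[OF \<phi>]
  define t where "t = (\<lambda>rs. mat_trace (\<phi> (mat_unit N rs)))"
  have comm: "mat_trace (\<phi> (B * C)) = mat_trace (\<phi> (C * B))"
    if "B \<in> carrier_mat N N" "C \<in> carrier_mat N N" for B C
    using that D(2) by (simp add: D(3) mat_trace_comm[of "\<phi> B" N N])
  \<comment> \<open>On the diagonal, \<open>E_r0 E_0r = E_rr\<close> is compared with
    \<open>E_0r E_r0 = E_00\<close>; off the diagonal, \<open>E_rr E_rs = E_rs\<close> with
    \<open>E_rs E_rr = 0\<close>.\<close>
  have t: "t (r, s) = (if r = s then t (0, 0) else 0)" if "r < N" "s < N" for r s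
  proof (cases "r = s")
    case True
    then show ?thesis
      using comm[of "mat_unit N (r, 0)" "mat_unit N (0, r)"] that by (simp add: t_def mat_unit_mult)
  next
    case False
    then show ?thesis
      using comm[of "mat_unit N (r, r)" "mat_unit N (r, s)"] that by (simp add: t_def mat_unit_mult D(5))
  qed
  have tr: "mat_trace (\<phi> B) = t (0, 0) * mat_trace B" if B: "B \<in> carrier_mat N N" for B
  proof -
    have "mat_trace (\<phi> B) = (\<Sum>i<N. \<Sum>rs\<in>{..<N} \<times> {..<N}. B $$ rs * \<phi> (mat_unit N rs) $$ (i, i))"
      using D(2)[OF B] by (auto simp: mat_trace_def mat_linear_expand[OF D(1) B] intro!: sum.cong)
    also have "\<dots> = (\<Sum>rs\<in>{..<N} \<times> {..<N}. B $$ rs * t rs)"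
      by (subst sum.swap)
        (simp add: t_def mat_trace_def sum_distrib_left carrier_matD[OF D(2)[OF mat_unit_carrier]])
    also have "\<dots> = (\<Sum>r<N. \<Sum>s<N. B $$ (r, s) * t (r, s))"
      by (simp add: sum.cartesian_product split_def)
    also have "\<dots> = (\<Sum>r<N. \<Sum>s<N. if s = r then B $$ (r, r) * t (0, 0) else 0)"
    proof (intro sum.cong refl)
      fix r s assume "r \<in> {..<N}" "s \<in> {..<N}"
      then show "B $$ (r, s) * t (r, s) = (if s = r then B $$ (r, r) * t (0, 0) else 0)"
        using t[of r s] by (cases "r = s") simp_all
    qed
    also have "\<dots> = t (0, 0) * mat_trace B"
      using B by (simp add: mat_trace_def sum_distrib_left mult.commute)
    finally show ?thesis .
  qed
  have "t (0, 0) = 1"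
    using tr[of "1\<^sub>m N"] False by (simp add: D(6))
  then show ?thesis
    using tr[OF A] by simp
qed

definition unit_amp :: "nat \<Rightarrow> nat \<Rightarrow> nat \<Rightarrow> nat \<Rightarrow> complex mat" where
  "unit_amp n m i j = kron n m (mat_unit n (i, j)) (1\<^sub>m m)"

lemma unit_amp_carrier [simp]: "unit_amp n m i j \<in> carrier_mat (n * m) (n * m)"
  by (simp add: unit_amp_def)

lemma matrix_units3_unit_amp:
  assumes "n \<ge> 3"
  shows "matrix_units3 (n * m) (real m) (unit_amp n m)"
  using assms
  by unfold_locales
    (auto simp: unit_amp_def kron_mult mat_unit_mult kron_adjoint mat_unit_adjoint mat_trace_kron mat_trace_mat_unit)

lemma matrix_units3_automorphism:
  assumes "matrix_units3 N m f" and \<phi>: "\<phi> \<in> star_automorphisms N"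
  shows "matrix_units3 N m (\<lambda>i j. \<phi> (f i j))"
proof -
  interpret matrix_units3 N m f by fact
  note D = star_automorphismsD[OF \<phi>]
  show ?thesis
    by unfold_locales
      (auto simp: D(2) mult D(5) trace mat_trace_automorphism[OF \<phi>] simp flip: D(3) D(4))
qed

lemma automorphism_antisymmetry_defect:
  assumes "n \<ge> 3" and \<phi>: "\<phi> \<in> star_automorphisms (n * m)"
  shows "3 * real m \<le> 730 * (3 * real m
    + (\<Sum>i<3. \<Sum>j<3. Re (mat_trace (\<phi> (unit_amp n m i j) * unit_amp n m i j))))"
proof -
  interpret F: matrix_units3 "n * m" "real m" "unit_amp n m"
    by (rule matrix_units3_unit_amp) fact
  interpret E: matrix_units3 "n * m" "real m" "\<lambda>i j. \<phi> (unit_amp n m i j)"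
    by (rule matrix_units3_automorphism[OF F.matrix_units3_axioms \<phi>])
  interpret matrix_units3_pair "n * m" "real m" "\<lambda>i j. \<phi> (unit_amp n m i j)" "unit_amp n m" ..
  show ?thesis
    using defect_lower_bound unfolding defect_def .
qed

section \<open>The antisymmetry functional\<close>

lemma cmod_index_le_op_norm:
  assumes A: "A \<in> carrier_mat N N" and le: "op_norm A \<le> ennreal K" "0 \<le> K" and rs: "r < N" "s < N"
  shows "cmod (A $$ (r, s)) \<le> K"
proof -
  have "l2_norm (unit_vec N s) = 1"
  proof -
    have "(\<Sum>i<N. (cmod (unit_vec N s $ i))\<^sup>2) = (\<Sum>i<N. if i = s then 1 else 0)"
      using rs by (intro sum.cong) auto
    then show ?thesis
      using rs by (simp add: l2_norm_def L2_set_def)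
  qed
  then have "ennreal (l2_norm (A *\<^sub>v unit_vec N s)) \<le> op_norm A"
    using A unfolding op_norm_def by (intro SUP_upper) auto
  then have "ennreal (l2_norm (A *\<^sub>v unit_vec N s)) \<le> ennreal K"
    using le(1) by (rule order_trans)
  then have "l2_norm (A *\<^sub>v unit_vec N s) \<le> K"
    using le(2) by (simp add: ennreal_le_iff)
  moreover have "A *\<^sub>v unit_vec N s = col A s"
    using A rs by (intro eq_vecI) (auto simp: scalar_prod_right_unit[of _ N])
  moreover have "cmod (col A s $ r) \<le> l2_norm (col A s)"
    using A rs member_le_L2_set[of "{..<N}" r "\<lambda>i. cmod (col A s $ i)"] by (simp add: l2_norm_def)
  ultimately show ?thesis
    using A rs by simp
qed

text \<open>The matrix moves the \<open>j\<close>-th block of a vector to position \<open>i\<close>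
  and kills all other blocks.\<close>

lemma op_norm_unit_amp_le:
  assumes "i < n" "j < n"
  shows "op_norm (unit_amp n m i j) \<le> 1"
proof -
  have "l2_norm (unit_amp n m i j *\<^sub>v v) \<le> l2_norm v" if v: "v \<in> carrier_vec (n * m)" for v
  proof -
    let ?w = "unit_amp n m i j *\<^sub>v v"
    have w: "?w $ (k * m + p) = (if k = i then v $ (j * m + p) else 0)" if "k < n" "p < m" for k p
    proof -
      have "?w $ (k * m + p) = (\<Sum>t<n * m. unit_amp n m i j $$ (k * m + p, t) * v $ t)"
        using v that mult_add_less[of k n p m]
        by (simp add: unit_amp_def carrier_matD[OF kron_carrier] scalar_prod_def atLeast0LessThan)
      also have "\<dots> = (\<Sum>l<n. \<Sum>q<m. unit_amp n m i j $$ (k * m + p, l * m + q) * v $ (l * m + q))"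
        by (simp add: sum_lessThan_mult)
      also have "\<dots> = (\<Sum>l<n. if l = j then if k = i then \<Sum>q<m. if q = p then v $ (j * m + q) else 0 else 0 else 0)"
      proof (intro sum.cong refl)
        fix l assume "l \<in> {..<n}"
        then show "(\<Sum>q<m. unit_amp n m i j $$ (k * m + p, l * m + q) * v $ (l * m + q))
          = (if l = j then if k = i then \<Sum>q<m. if q = p then v $ (j * m + q) else 0 else 0 else 0)"
          using that by (auto simp: unit_amp_def kron_index mat_unit_def if_distrib[of "\<lambda>x. x * _"] if_distrib[of "\<lambda>x. _ * x"] cong: if_cong)
      qed
      also have "\<dots> = (if k = i then v $ (j * m + p) else 0)"
        using assms that by simp
      finally show ?thesis .
    qed
    have "(\<Sum>t<n * m. (cmod (?w $ t))\<^sup>2) = (\<Sum>k<n. if k = i then \<Sum>p<m. (cmod (v $ (j * m + p)))\<^sup>2 else 0)"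
      unfolding sum_lessThan_mult by (intro sum.cong refl) (simp add: w)
    also have "\<dots> = (\<Sum>p<m. (cmod (v $ (j * m + p)))\<^sup>2)"
      using assms by simp
    also have "\<dots> \<le> (\<Sum>k<n. \<Sum>p<m. (cmod (v $ (k * m + p)))\<^sup>2)"
      using assms by (intro member_le_sum[of j "{..<n}" "\<lambda>k. \<Sum>p<m. (cmod (v $ (k * m + p)))\<^sup>2"])
        (auto intro: sum_nonneg)
    finally have "(\<Sum>t<n * m. (cmod (?w $ t))\<^sup>2) \<le> (\<Sum>t<n * m. (cmod (v $ t))\<^sup>2)"
      by (simp add: sum_lessThan_mult)
    then show ?thesis
      using v by (simp add: l2_norm_def L2_set_def unit_amp_def carrier_matD[OF kron_carrier])
  qed
  then show ?thesis
    unfolding op_norm_def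
    by (intro SUP_least) (auto simp: unit_amp_def carrier_matD[OF kron_carrier]
        simp flip: ennreal_1 intro!: ennreal_leI intro: order_trans)
qed

text \<open>The first amplification is the map itself. The whole obstruction is thus already visible
  in the operator norm.\<close>

lemma op_norm_le_cb_norm:
  assumes X: "X \<in> carrier_mat N N" "op_norm X \<le> 1" and SX: "S X \<in> carrier_mat N N"
  shows "op_norm (S X) \<le> cb_norm N S"
proof -
  have "mat_block N X 0 0 = X"
    using X by (intro eq_matI) (auto simp: mat_block_def)
  then have amp: "amplify 1 N S X = S X"
    using SX by (intro eq_matI) (auto simp: amplify_def)
  have "op_norm (S X) \<le> (SUP X\<in>{X\<in>carrier_mat (1 * N) (1 * N). op_norm X \<le> 1}. op_norm (amplify 1 N S X))"
    unfolding amp[symmetric] using X by (intro SUP_upper) auto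
  also have "\<dots> \<le> cb_norm N S"
    unfolding cb_norm_def by (intro SUP_upper[of "1::nat"]) auto
  finally show ?thesis .
qed

definition antisymmetry :: "nat \<Rightarrow> nat \<Rightarrow> (complex mat \<Rightarrow> complex mat) \<Rightarrow> complex" where
  "antisymmetry n m S = (\<Sum>i<3. \<Sum>j<3. mat_trace (S (unit_amp n m i j) * unit_amp n m i j))"

text \<open>Only the diagonal of one block survives. With \<open>m\<close> entries instead of
  \<open>n * m\<close>, each summand of the functional is bounded by \<open>m\<close> times an entry
  bound.\<close>

lemma mat_trace_mult_unit_amp:
  assumes "A \<in> carrier_mat (n * m) (n * m)" "i < n" "j < n"
  shows "mat_trace (A * unit_amp n m i j) = (\<Sum>p<m. A $$ (j * m + p, i * m + p))"
proof -
  have "mat_trace (A * unit_amp n m i j)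
      = (\<Sum>k<n. \<Sum>p<m. \<Sum>l<n. \<Sum>q<m. A $$ (k * m + p, l * m + q) * unit_amp n m i j $$ (l * m + q, k * m + p))"
    using assms by (simp add: mat_trace_mult[of _ "n * m" "n * m"] sum_lessThan_mult)
  also have "\<dots> = (\<Sum>k<n. if k = j then \<Sum>p<m. \<Sum>l<n. if l = i then
      \<Sum>q<m. if q = p then A $$ (j * m + p, i * m + p) else 0 else 0 else 0)"
  proof (intro sum.cong refl)
    fix k assume k: "k \<in> {..<n}"
    have *: "(\<Sum>q<m. A $$ (k * m + p, l * m + q) * unit_amp n m i j $$ (l * m + q, k * m + p))
      = (if k = j then if l = i then \<Sum>q<m. if q = p then A $$ (j * m + p, i * m + p) else 0 else 0 else 0)"
      if "p < m" "l < n" for p l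
      using that k by (auto simp: unit_amp_def kron_index mat_unit_def if_distrib[of "\<lambda>x. x * _"] if_distrib[of "\<lambda>x. _ * x"] cong: if_cong)
    show "(\<Sum>p<m. \<Sum>l<n. \<Sum>q<m. A $$ (k * m + p, l * m + q) * unit_amp n m i j $$ (l * m + q, k * m + p))
      = (if k = j then \<Sum>p<m. \<Sum>l<n. if l = i then
      \<Sum>q<m. if q = p then A $$ (j * m + p, i * m + p) else 0 else 0 else 0)"
      by (simp add: *)
  qed
  also have "\<dots> = (\<Sum>p<m. A $$ (j * m + p, i * m + p))"
    using assms by simp
  finally show ?thesis .
qed

lemma cmod_antisymmetry_diff_le:
  assumes n: "n \<ge> 3" and S: "\<And>X. X \<in> carrier_mat (n * m) (n * m) \<Longrightarrow> S X \<in> carrier_mat (n * m) (n * m)"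
    and R: "\<And>X. X \<in> carrier_mat (n * m) (n * m) \<Longrightarrow> R X \<in> carrier_mat (n * m) (n * m)"
    and K: "cb_norm (n * m) (\<lambda>X. S X - R X) \<le> ennreal K" "0 \<le> K"
  shows "cmod (antisymmetry n m S - antisymmetry n m R) \<le> 9 * (real m * K)"
proof -
  have one: "cmod (mat_trace (S (unit_amp n m i j) * unit_amp n m i j)
      - mat_trace (R (unit_amp n m i j) * unit_amp n m i j)) \<le> real m * K" if "i < n" "j < n" for i j
  proof -
    let ?u = "unit_amp n m i j"
    have c: "S ?u - R ?u \<in> carrier_mat (n * m) (n * m)"
      using R[of ?u] by (intro minus_carrier_mat) simp
    have "op_norm (S ?u - R ?u) \<le> cb_norm (n * m) (\<lambda>X. S X - R X)"
      using c that by (intro op_norm_le_cb_norm[where S = "\<lambda>X. S X - R X"] op_norm_unit_amp_le) auto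
    then have op: "op_norm (S ?u - R ?u) \<le> ennreal K"
      using K(1) by (rule order_trans)
    have "mat_trace (S ?u * ?u) - mat_trace (R ?u * ?u) = (\<Sum>p<m. (S ?u - R ?u) $$ (j * m + p, i * m + p))"
      using S[of ?u] R[of ?u] that by (simp add: mat_trace_mult_unit_amp mult_add_less sum_subtractf)
    also have "cmod \<dots> \<le> (\<Sum>p<m. K)"
      using that by (intro sum_norm_le cmod_index_le_op_norm[OF c op K(2)] mult_add_less) auto
    finally show ?thesis by simp
  qed
  have "cmod (antisymmetry n m S - antisymmetry n m R) \<le> (\<Sum>i<(3::nat). \<Sum>j<(3::nat). real m * K)"
    unfolding antisymmetry_def sum_subtractf[symmetric] using n
    by (intro sum_norm_le one) auto
  then show ?thesis by simp
qed

text \<open>The bound for automorphisms is affine in the map, so it passes to convex combinations;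
  the constant \<open>3 * m\<close> is distributed using that the weights sum to 1.\<close>

lemma antisymmetry_conv_automorphisms:
  assumes n: "n \<ge> 3" and R: "R \<in> conv_maps (n * m) (star_automorphisms (n * m))"
  shows "3 * real m \<le> 730 * (3 * real m + Re (antisymmetry n m R))"
proof -
  obtain l :: nat and c \<phi> where *: "(\<forall>i<l. 0 \<le> c i \<and> \<phi> i \<in> star_automorphisms (n * m)) \<and> (\<Sum>i<l. c i) = 1 \<and>
      (\<forall>X\<in>carrier_mat (n * m) (n * m).
        R X = mat (n * m) (n * m) (\<lambda>rs. \<Sum>i<l. complex_of_real (c i) * \<phi> i X $$ rs))"
    using R unfolding conv_maps_def mem_Collect_eq by auto
  then have c: "\<And>i. i < l \<Longrightarrow> 0 \<le> c i" "(\<Sum>i<l. c i) = 1"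
    and \<phi>: "\<And>i. i < l \<Longrightarrow> \<phi> i \<in> star_automorphisms (n * m)"
    and R: "\<And>X. X \<in> carrier_mat (n * m) (n * m) \<Longrightarrow>
      R X = mat (n * m) (n * m) (\<lambda>rs. \<Sum>i<l. complex_of_real (c i) * \<phi> i X $$ rs)"
    by auto
  have tr: "mat_trace (R (unit_amp n m i j) * unit_amp n m i j)
      = (\<Sum>t<l. complex_of_real (c t) * mat_trace (\<phi> t (unit_amp n m i j) * unit_amp n m i j))"
    if "i < n" "j < n" for i j
  proof -
    have "mat_trace (R (unit_amp n m i j) * unit_amp n m i j)
      = (\<Sum>p<m. \<Sum>t<l. complex_of_real (c t) * \<phi> t (unit_amp n m i j) $$ (j * m + p, i * m + p))"
      using that by (subst mat_trace_mult_unit_amp) (auto simp: R mult_add_less)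
    also have "\<dots> = (\<Sum>t<l. complex_of_real (c t) * (\<Sum>p<m. \<phi> t (unit_amp n m i j) $$ (j * m + p, i * m + p)))"
      by (subst sum.swap) (simp add: sum_distrib_left)
    also have "\<dots> = (\<Sum>t<l. complex_of_real (c t) * mat_trace (\<phi> t (unit_amp n m i j) * unit_amp n m i j))"
      using that star_automorphismsD(2)[OF \<phi>]
      by (intro sum.cong refl) (simp add: mat_trace_mult_unit_amp)
    finally show ?thesis .
  qed
  have "antisymmetry n m R = (\<Sum>t<l. complex_of_real (c t) * antisymmetry n m (\<phi> t))"
  proof -
    have "antisymmetry n m R = (\<Sum>i<3. \<Sum>j<3. \<Sum>t<l. complex_of_real (c t) * mat_trace (\<phi> t (unit_amp n m i j) * unit_amp n m i j))"
      unfolding antisymmetry_def using n by (intro sum.cong refl tr) auto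
    then show ?thesis
      by (simp add: antisymmetry_def sum_lessThan_3 distrib_left sum.distrib)
  qed
  then have "3 * real m + Re (antisymmetry n m R) = (\<Sum>t<l. c t * (3 * real m + Re (antisymmetry n m (\<phi> t))))"
    using c(2) by (simp add: distrib_left sum.distrib flip: sum_distrib_right)
  also have "\<dots> \<ge> (\<Sum>t<l. c t * (3 * real m / 730))"
    using automorphism_antisymmetry_defect[OF n \<phi>] c(1)
    by (intro sum_mono mult_left_mono) (auto simp: antisymmetry_def mult.commute)
  also have "(\<Sum>t<l. c t * (3 * real m / 730)) = 3 * real m / 730"
    using c(2) by (simp only: sum_distrib_right[symmetric] mult_1)
  finally show ?thesis by (simp add: field_simps)
qed

section \<open>The Werner--Holevo channel\<close>

lemma cscalar_prod_mult_mat_vec: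
  fixes A :: "complex mat"
  assumes "A \<in> carrier_mat N N" "v \<in> carrier_vec N"
  shows "(A *\<^sub>v v) \<bullet>c v = (\<Sum>r<N. \<Sum>s<N. A $$ (r, s) * v $ s * cnj (v $ r))"
  using assms by (simp add: scalar_prod_def atLeast0LessThan sum_distrib_right)

lemma psd_sum_nonneg:
  assumes "psd N A"
  shows "0 \<le> (\<Sum>r<N. \<Sum>s<N. A $$ (r, s) * w s * cnj (w r))"
proof -
  have A: "A \<in> carrier_mat N N" and "0 \<le> (A *\<^sub>v vec N w) \<bullet>c vec N w"
    using assms by (auto simp: psd_def)
  then show ?thesis
    by (simp add: cscalar_prod_mult_mat_vec[OF A])
qed

lemma sum_lessThan_split3:
  fixes h :: "nat \<Rightarrow> 'a :: comm_monoid_add"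
  assumes "n \<ge> 3"
  shows "(\<Sum>p<n. h p) = h 0 + (h 1 + (h 2 + (\<Sum>p\<in>{3..<n}. h p)))"
proof -
  have "(\<Sum>p<n. h p) = (\<Sum>p<3. h p) + (\<Sum>p\<in>{3..<n}. h p)"
    using sum.atLeastLessThan_concat[of 0 3 n h] assms by (simp add: atLeast0LessThan)
  then show ?thesis
    by (simp add: sum_lessThan_3 add.assoc)
qed

definition werner_holevo :: "nat \<Rightarrow> complex mat \<Rightarrow> complex mat" where
  "werner_holevo n X = mat n n (\<lambda>(p, q).
     if p < 3 \<and> q < 3 then ((if p = q then \<Sum>a<3. X $$ (a, a) else 0) - X $$ (q, p)) / 2
     else if 3 \<le> p \<and> 3 \<le> q then X $$ (p, q) else 0)"

lemma mat_linear_werner_holevo: "n \<ge> 3 \<Longrightarrow> mat_linear n n (werner_holevo n)"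
  unfolding mat_linear_def werner_holevo_def
  by (intro conjI ballI allI Pi_I eq_matI)
    (auto simp: sum_lessThan_3 field_simps)

text \<open>The action of the Kraus operator \<open>E\<^sub>a\<^sub>b - E\<^sub>b\<^sub>a\<close> on vectors.\<close>

definition skew_swap :: "nat \<Rightarrow> nat \<Rightarrow> (nat \<Rightarrow> complex) \<Rightarrow> nat \<Rightarrow> complex" where
  "skew_swap a b x p = (if p = a then x b else if p = b then - x a else 0)"

lemma sum_skew_swap:
  assumes "a < n" "b < n" "a \<noteq> b"
  shows "(\<Sum>p<n. h p * skew_swap a b x p) = h a * x b - h b * x a"
proof -
  have "(\<Sum>p<n. h p * skew_swap a b x p)
      = (\<Sum>p<n. (if p = a then h a * x b else 0) + (if p = b then - (h b * x a) else 0))"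
    using assms by (intro sum.cong refl) (simp add: skew_swap_def)
  also have "\<dots> = h a * x b - h b * x a"
    using assms by (simp add: sum.distrib)
  finally show ?thesis .
qed

lemma cnj_skew_swap: "cnj (skew_swap a b x p) = skew_swap a b (\<lambda>p. cnj (x p)) p"
  by (simp add: skew_swap_def)

lemma skew_swap_form:
  assumes "a < n" "b < n" "a \<noteq> b"
  shows "(\<Sum>p<n. \<Sum>q<n. B $$ (p, q) * skew_swap a b y q * cnj (skew_swap a b x p))
    = B $$ (a, a) * y b * cnj (x b) - B $$ (a, b) * y a * cnj (x b)
      - B $$ (b, a) * y b * cnj (x a) + B $$ (b, b) * y a * cnj (x a)"
proof -
  have "(\<Sum>p<n. \<Sum>q<n. B $$ (p, q) * skew_swap a b y q * cnj (skew_swap a b x p))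
      = (\<Sum>p<n. (\<Sum>q<n. B $$ (p, q) * skew_swap a b y q) * skew_swap a b (\<lambda>p. cnj (x p)) p)"
    by (simp add: sum_distrib_right cnj_skew_swap)
  also have "\<dots> = (B $$ (a, a) * y b - B $$ (a, b) * y a) * cnj (x b)
      - (B $$ (b, a) * y b - B $$ (b, b) * y a) * cnj (x a)"
    by (simp only: sum_skew_swap[OF assms])
  finally show ?thesis
    by (simp add: algebra_simps)
qed

text \<open>The Kraus decomposition as a sesquilinear form: three operators
  \<open>E_ab - E_ba\<close>, weighted by 1/2, and the projection onto the complementary corner.
  Distinct \<open>x\<close> and \<open>y\<close> are allowed because the blocks of an amplification
  pair different components of a vector.\<close>

lemma werner_holevo_kraus:
  assumes n: "n \<ge> 3"
  shows "(\<Sum>p<n. \<Sum>q<n. werner_holevo n B $$ (p, q) * y q * cnj (x p))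
    = (\<Sum>(a, b)\<in>{(0, 1), (0, 2), (1, 2)}.
        (\<Sum>p<n. \<Sum>q<n. B $$ (p, q) * skew_swap a b y q * cnj (skew_swap a b x p)) / 2)
      + (\<Sum>p<n. \<Sum>q<n. B $$ (p, q) * (if 3 \<le> q then y q else 0) * cnj (if 3 \<le> p then x p else 0))"
proof -
  define W where "W p q = werner_holevo n B $$ (p, q) * y q * cnj (x p)" for p q
  define V where "V p q = B $$ (p, q) * (if 3 \<le> q then y q else 0) * cnj (if 3 \<le> p then x p else 0)" for p q
  have W: "W p q = (if p = q then (B $$ (0, 0) + B $$ (1, 1) + B $$ (2, 2) - B $$ (q, p)) / 2
      else - B $$ (q, p) / 2) * y q * cnj (x p)" if "p < 3" "q < 3" for p q
    using that n by (simp add: W_def werner_holevo_def sum_lessThan_3)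
  have "(\<Sum>q<n. W p q) = W p 0 + (W p 1 + W p 2)" if "p < 3" for p
    unfolding sum_lessThan_split3[OF n] using that n
    by (simp add: W_def werner_holevo_def)
  moreover have "(\<Sum>q<n. W p q) = (\<Sum>q<n. V p q)" if "p \<in> {3..<n}" for p
    using that by (intro sum.cong refl) (simp add: W_def V_def werner_holevo_def)
  moreover have "(\<Sum>q<n. V p q) = 0" if "p < 3" for p
    using that by (simp add: V_def)
  ultimately have "(\<Sum>p<n. \<Sum>q<n. W p q)
      = (W 0 0 + (W 0 1 + W 0 2)) + (W 1 0 + (W 1 1 + W 1 2)) + (W 2 0 + (W 2 1 + W 2 2)) + (\<Sum>p<n. \<Sum>q<n. V p q)"
    unfolding sum_lessThan_split3[OF n, of "\<lambda>p. \<Sum>q<n. W p q"] sum_lessThan_split3[OF n, of "\<lambda>p. \<Sum>q<n. V p q"]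
    by simp
  moreover have "(W 0 0 + (W 0 1 + W 0 2)) + (W 1 0 + (W 1 1 + W 1 2)) + (W 2 0 + (W 2 1 + W 2 2))
    = (\<Sum>(a, b)\<in>{(0, 1), (0, 2), (1, 2)}.
        (\<Sum>p<n. \<Sum>q<n. B $$ (p, q) * skew_swap a b y q * cnj (skew_swap a b x p)) / 2)"
    using n by (simp add: W skew_swap_form) (simp add: field_simps)
  ultimately show ?thesis
    unfolding W_def V_def by simp
qed

lemma completely_positive_werner_holevo:
  assumes n: "n \<ge> 3"
  shows "completely_positive n (werner_holevo n)"
  unfolding completely_positive_def
proof (intro conjI allI impI)
  show "mat_linear n n (werner_holevo n)"
    using n by (rule mat_linear_werner_holevo)
  fix m Y assume psd: "psd (m * n) Y"
  have amp: "amplify m n (werner_holevo n) Y \<in> carrier_mat (m * n) (m * n)"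
    by (simp add: amplify_def)
  show "psd (m * n) (amplify m n (werner_holevo n) Y)"
    unfolding psd_def
  proof (intro conjI ballI amp)
    fix v :: "complex vec" assume v: "v \<in> carrier_vec (m * n)"
    define x where "x i = (\<lambda>p. v $ (i * n + p))" for i
    \<comment> \<open>The quadratic form of \<open>Y\<close> at the vector obtained by applying
      \<open>L\<close> to each block of \<open>v\<close>; with \<open>L\<close> a Kraus operator
      these are the summands of the form of the amplification.\<close>
    define Q where "Q L = (\<Sum>i<m. \<Sum>p<n. \<Sum>j<m. \<Sum>q<n. Y $$ (i * n + p, j * n + q) * L (x j) q * cnj (L (x i) p))"
      for L :: "(nat \<Rightarrow> complex) \<Rightarrow> nat \<Rightarrow> complex"
    have Q: "0 \<le> Q L" for L
    proof -
      have "Q L = (\<Sum>r<m * n. \<Sum>s<m * n. Y $$ (r, s) * L (x (s div n)) (s mod n) * cnj (L (x (r div n)) (r mod n)))"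
        unfolding Q_def sum_lessThan_mult by (intro sum.cong refl) simp
      then show ?thesis
        using psd_sum_nonneg[OF psd, of "\<lambda>r. L (x (r div n)) (r mod n)"] by simp
    qed
    have Q_block: "Q L = (\<Sum>i<m. \<Sum>j<m. \<Sum>p<n. \<Sum>q<n. mat_block n Y i j $$ (p, q) * L (x j) q * cnj (L (x i) p))" for L
      unfolding Q_def
    proof (rule sum.cong[OF refl])
      fix i
      show "(\<Sum>p<n. \<Sum>j<m. \<Sum>q<n. Y $$ (i * n + p, j * n + q) * L (x j) q * cnj (L (x i) p))
        = (\<Sum>j<m. \<Sum>p<n. \<Sum>q<n. mat_block n Y i j $$ (p, q) * L (x j) q * cnj (L (x i) p))"
        by (subst sum.swap) (simp add: mat_block_def)
    qed
    have "(amplify m n (werner_holevo n) Y *\<^sub>v v) \<bullet>c v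
      = (\<Sum>i<m. \<Sum>p<n. \<Sum>j<m. \<Sum>q<n. werner_holevo n (mat_block n Y i j) $$ (p, q) * x j q * cnj (x i p))"
      unfolding cscalar_prod_mult_mat_vec[OF amp v] sum_lessThan_mult x_def
      by (intro sum.cong refl) (simp add: amplify_def mult_add_less)
    also have "\<dots> = (\<Sum>i<m. \<Sum>j<m. \<Sum>p<n. \<Sum>q<n. werner_holevo n (mat_block n Y i j) $$ (p, q) * x j q * cnj (x i p))"
      by (intro sum.cong refl sum.swap)
    also have "\<dots> = (\<Sum>i<m. \<Sum>j<m. (\<Sum>(a, b)\<in>{(0, 1), (0, 2), (1, 2)}.
        (\<Sum>p<n. \<Sum>q<n. mat_block n Y i j $$ (p, q) * skew_swap a b (x j) q * cnj (skew_swap a b (x i) p)) / 2)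
      + (\<Sum>p<n. \<Sum>q<n. mat_block n Y i j $$ (p, q) * (if 3 \<le> q then x j q else 0) * cnj (if 3 \<le> p then x i p else 0)))"
      by (intro sum.cong refl werner_holevo_kraus[OF n])
    also have "\<dots> = Q (skew_swap 0 1) / 2 + Q (skew_swap 0 2) / 2 + Q (skew_swap 1 2) / 2
        + Q (\<lambda>y q. if 3 \<le> q then y q else 0)"
      unfolding Q_block by (simp add: sum.distrib sum_divide_distrib)
    also have "0 \<le> \<dots>"
    proof -
      have "0 \<le> Q L / 2" for L
        using Q[of L] by (simp add: less_eq_complex_def)
      then show ?thesis
        using Q by (intro add_nonneg_nonneg)
    qed
    finally show "0 \<le> (amplify m n (werner_holevo n) Y *\<^sub>v v) \<bullet>c v" .
  qed
qed

text \<open>On the corner, unitality and trace preservation both rest on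
  \<open>(3 - 1) / 2 = 1\<close>.\<close>

lemma markov_map_werner_holevo:
  assumes n: "n \<ge> 3"
  shows "markov_map n (werner_holevo n)"
  unfolding markov_map_def
proof (intro conjI ballI)
  show "completely_positive n (werner_holevo n)"
    using n by (rule completely_positive_werner_holevo)
  show "werner_holevo n (1\<^sub>m n) = 1\<^sub>m n"
    using n by (intro eq_matI) (auto simp: werner_holevo_def sum_lessThan_3)
  fix X :: "complex mat" assume "X \<in> carrier_mat n n"
  have "(\<Sum>i<n. werner_holevo n X $$ (i, i)) = (\<Sum>i<n. X $$ (i, i))"
  proof -
    have "(\<Sum>i\<in>{3..<n}. werner_holevo n X $$ (i, i)) = (\<Sum>i\<in>{3..<n}. X $$ (i, i))"
      by (intro sum.cong) (auto simp: werner_holevo_def)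
    moreover have d: "werner_holevo n X $$ (i, i) = (X $$ (0, 0) + X $$ (1, 1) + X $$ (2, 2) - X $$ (i, i)) / 2" if "i < 3" for i
      using that n by (simp add: werner_holevo_def sum_lessThan_3)
    ultimately show ?thesis
      unfolding sum_lessThan_split3[OF n] by (simp add: d[of 0] d[of "Suc 0"] d[of 2]) (simp add: field_simps)
  qed
  then show "norm_trace n (werner_holevo n X) = norm_trace n X"
    by (simp add: norm_trace_def)
qed

text \<open>The six off-diagonal pairs contribute \<open>- 1 / 2\<close> each, which gives the value
  -3 in the functional.\<close>

lemma werner_holevo_mat_unit:
  assumes "n \<ge> 3" "i < 3" "j < 3"
  shows "werner_holevo n (mat_unit n (i, j)) $$ (j, i) = (if i = j then 0 else - 1 / 2)"
  using assms by (auto simp: werner_holevo_def mat_unit_def)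

section \<open>Tensor powers and the contradiction\<close>

lemma mat_linear_tensor_map: "mat_linear (a * b) (a * b) (tensor_map a b S R)"
  unfolding mat_linear_def tensor_map_def
proof (intro conjI ballI allI Pi_I eq_matI, goal_cases)
  case (2 X Y r s)
  then show ?case
    by (simp add: split_def mem_Times_iff mult_add_less distrib_right sum.distrib cong: sum.cong_simp)
next
  case (5 c X r s)
  then show ?case
    by (simp add: split_def mem_Times_iff mult_add_less sum_distrib_left mult.assoc cong: sum.cong_simp)
qed auto

text \<open>The two claims go through one induction, since \<open>tensor_map_kron\<close>, which
  yields unitality, requires the smaller power to be linear.\<close>

lemma tensor_power_linear_unital:
  assumes T: "mat_linear n n T" "T (1\<^sub>m n) = 1\<^sub>m n"
  shows "mat_linear (n ^ k) (n ^ k) (tensor_power n T k) \<and> tensor_power n T k (1\<^sub>m (n ^ k)) = 1\<^sub>m (n ^ k)"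
proof (induction k)
  case 0
  then show ?case by (simp add: mat_linear_def)
next
  case (Suc k)
  then show ?case
    using tensor_map_kron[of n T "n ^ k" "tensor_power n T k" "1\<^sub>m n" "1\<^sub>m (n ^ k)"] T
    by (simp add: mat_linear_tensor_map kron_one)
qed

text \<open>The test matrices are trivial on all legs but the first, and the remaining power is
  unital. Relative to \<open>n ^ k\<close> the value is therefore independent of \<open>k\<close>,
  which is why tensoring does not weaken the obstruction.\<close>

lemma antisymmetry_tensor_power:
  assumes n: "n \<ge> 3" and T: "mat_linear n n T" "T (1\<^sub>m n) = 1\<^sub>m n"
  shows "antisymmetry n (n ^ k) (tensor_power n T (Suc k))
    = of_nat (n ^ k) * (\<Sum>i<3. \<Sum>j<3. T (mat_unit n (i, j)) $$ (j, i))"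
proof -
  have "mat_trace (tensor_power n T (Suc k) (unit_amp n (n ^ k) i j) * unit_amp n (n ^ k) i j)
      = of_nat (n ^ k) * T (mat_unit n (i, j)) $$ (j, i)" if "i < 3" "j < 3" for i j
  proof -
    have "tensor_power n T (Suc k) (unit_amp n (n ^ k) i j) = kron n (n ^ k) (T (mat_unit n (i, j))) (1\<^sub>m (n ^ k))"
      unfolding unit_amp_def
      using tensor_map_kron[of n T "n ^ k" "tensor_power n T k" "mat_unit n (i, j)" "1\<^sub>m (n ^ k)"]
        tensor_power_linear_unital[OF T, of k] T by simp
    then show ?thesis
      using that n by (simp add: mat_trace_mult_unit_amp kron_index)
  qed
  then show ?thesis
    by (simp add: antisymmetry_def sum_distrib_left)
qed

theorem theorem6p1:
  fixes n :: nat
  assumes "n \<ge> 3"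
  shows "\<exists>T. markov_map n T \<and> \<not> asymptotic_quantum_birkhoff n T"
proof (intro exI conjI notI)
  note n = assms
  let ?T = "werner_holevo n"
  show markov: "markov_map n ?T"
    using n by (rule markov_map_werner_holevo)
  then have T: "mat_linear n n ?T" "?T (1\<^sub>m n) = 1\<^sub>m n"
    by (auto simp: markov_map_def completely_positive_def)
  \<comment> \<open>Any \<open>K < 1 / 2190\<close> works: the contradiction needs
    \<open>9 * K < 3 / 730\<close>.\<close>
  define K :: real where "K = 1 / 3000"
  assume "asymptotic_quantum_birkhoff n ?T"
  then have "\<forall>\<^sub>F k in sequentially. cb_dist (n ^ k) (tensor_power n ?T k)
      (conv_maps (n ^ k) (star_automorphisms (n ^ k))) < ennreal K"
    unfolding asymptotic_quantum_birkhoff_def by (rule order_tendstoD) (simp add: K_def)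
  \<comment> \<open>A successor exponent is chosen in order to split off the first leg on which the
    functional acts.\<close>
  then obtain k where "cb_dist (n ^ Suc k) (tensor_power n ?T (Suc k))
      (conv_maps (n ^ Suc k) (star_automorphisms (n ^ Suc k))) < ennreal K"
    unfolding eventually_sequentially by (meson le_SucI order_refl)
  moreover define m where "m = n ^ k"
  ultimately have "cb_dist (n * m) (tensor_power n ?T (Suc k))
      (conv_maps (n * m) (star_automorphisms (n * m))) < ennreal K"
    by simp
  then obtain R where R: "R \<in> conv_maps (n * m) (star_automorphisms (n * m))"
    and close: "cb_norm (n * m) (\<lambda>X. tensor_power n ?T (Suc k) X - R X) < ennreal K"
    unfolding cb_dist_def INF_less_iff by blast
  have "antisymmetry n m (tensor_power n ?T (Suc k)) = - (3 * of_nat m)"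
    unfolding m_def antisymmetry_tensor_power[OF n T]
    using n by (simp add: werner_holevo_mat_unit sum_lessThan_3)
  moreover have "cmod (antisymmetry n m (tensor_power n ?T (Suc k)) - antisymmetry n m R) \<le> 9 * (real m * K)"
  proof (rule cmod_antisymmetry_diff_le[OF n])
    show "tensor_power n ?T (Suc k) X \<in> carrier_mat (n * m) (n * m)" if "X \<in> carrier_mat (n * m) (n * m)" for X
      using tensor_power_linear_unital[OF T, of "Suc k"] that by (auto simp: mat_linear_def m_def)
    show "R X \<in> carrier_mat (n * m) (n * m)" if "X \<in> carrier_mat (n * m) (n * m)" for X
      using R that by (auto simp: conv_maps_def)
  qed (use close in \<open>auto simp: K_def\<close>)
  ultimately have "Re (antisymmetry n m R) \<le> - (3 * real m) + 9 * (real m * K)"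
    using complex_Re_le_cmod[of "antisymmetry n m R + 3 * of_nat m"] by (simp add: norm_minus_commute add.commute)
  moreover have "3 * real m \<le> 730 * (3 * real m + Re (antisymmetry n m R))"
    using n R by (rule antisymmetry_conv_automorphisms)
  moreover have "real m > 0"
    using n by (simp add: m_def)
  \<comment> \<open>The two estimates combine to
    \<open>3 * m \<le> 730 * 9 * m / 3000 = 2.19 * m\<close>, impossible for
    \<open>m > 0\<close>.\<close>
  ultimately show False
    by (simp add: K_def)
qed

end
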